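(* For every $\epsilon>0$ there are constants $Q=Q(\epsilon)$ and $P=P(\epsilon)$ such that the following holds. Let $q=p^n$ be a prime power with $q>Q$ and $p>P$, let $\delta>0$, and let $d$ be a divisor of $q-1$ with $2\le d\le q^{1/4-\epsilon}\delta^{3/2}$ such that the pair $(d,q)$ is $\delta$-good. Then there are no sets $A,B,C\subset\mathbb{F}_q$ with $|A|,|B|,|C|\ge2$ and $S_d=A+B+C$, where $S_d=\{x^d:x\in\mathbb{F}_q^*\}$.
   Context: $\mathbb{F}_q$ is the finite field with $q$ elements, $q=p^n$, $p$ prime. $A+B+C=\{a+b+c:a\in A,b\in B,c\in C\}$. For $d\mid(q-1)$ with $2\le d<q-1$, write the base-$p$ expansion $\frac{q-1}{d}=\sum_{j=0}^n e_jp^j$ with $0\le e_j\le p-1$. For a positive real $\delta$, the pair $(d,q)$ is called $\delta$-good if $e_j\le\lfloor(1-\delta)(p-1)\rfloor$ for every integer $j$ with $0\le j<(n+1)/2$. *)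

theory Defs
  imports
    Complex_Main
    "HOL-Algebra.AbelCoset"
    "HOL-Computational_Algebra.Primes"
begin

text \<open>
  The subgroup $S_d$ of nonzero $d$-th powers of a field given by its ring record. Finite fields
  are represented as ring records rather than as types of a type class because the constants
  of the theorem have to be uniform in the field, so that fields must be quantified inside a
  formula. Every finite field has an isomorphic copy with carrier in any given infinite type,
  so quantifying over the records on one such type covers all finite fields.
\<close>

definition nonzero_powers :: "('a, 'm) ring_scheme \<Rightarrow> nat \<Rightarrow> 'a set" where
  "nonzero_powers F d = {x [^]\<^bsub>F\<^esub> d | x. x \<in> carrier F - {\<zero>\<^bsub>F\<^esub>}}"

text \<open>
  $\delta$-goodness of the pair $(d, q)$ where $q = p^n$; the prime $p$ and the exponent $n$, which
  $q$ determines, are passed instead of $q$. The function \<open>e\<close> is the base-$p$ expansion of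
  $(q - 1)/d$, and \<open>2 * j < n + 1\<close> is $j < (n + 1)/2$. The bound is compared in the integers
  because it is negative for $\delta > 1$.
\<close>

definition delta_good :: "real \<Rightarrow> nat \<Rightarrow> nat \<Rightarrow> nat \<Rightarrow> bool" where
  "delta_good \<delta> p n d \<longleftrightarrow>
     (\<exists>e :: nat \<Rightarrow> nat.
        (\<forall>j\<le>n. e j \<le> p - 1) \<and>
        (p ^ n - 1) div d = (\<Sum>j=0..n. e j * p ^ j) \<and>
        (\<forall>j. 2 * j < n + 1 \<longrightarrow> int (e j) \<le> \<lfloor>(1 - \<delta>) * (real p - 1)\<rfloor>))"

end

theory Submission
  imports
    "HOL-Algebra.Weak_Morphisms"
    "HOL-Algebra.Algebraic_Closure_Type"
    "HOL-Library.Z2"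
    "HOL-Computational_Algebra.Computational_Algebra"
    Defs
begin

text \<open>
  Let \<open>S\<close> be the group of nonzero \<open>d\<close>-th powers, of order \<open>N = (q - 1)/d\<close>, and let \<open>S = A + B + C\<close>.
  Ruzsa's inequality \<open>|A + B + C|^2 \<le> |A + B| |A + C| |B + C|\<close> contradicts
  \<open>N \<ge> q^(3/4 + \<epsilon>)/2\<close> as soon as each of the three sums has size at most \<open>q^(1/2 + o(1))\<close>.

  Now \<open>A + B\<close> lies in the intersection of the translates \<open>S - c\<close> with \<open>c \<in> C\<close>. Stepanov's method,
  with an auxiliary polynomial built from all products of the functions \<open>(x + c)^(N e)\<close>, \<open>e < d\<close>, gives
  the bound \<open>q^(1/2 + o(1))\<close> when about \<open>log q / (2 log d)\<close> translates are available. If \<open>C\<close> is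
  smaller, at most quadratic products suffice to show that \<open>A + B\<close> has fewer than \<open>N/|C|\<close> elements,
  which is impossible. Only \<open>d = |C| = 2\<close> is left out; there every element of \<open>S\<close> would have one
  of its two translates by the difference of the elements of \<open>C\<close> in \<open>S\<close>, and three translates with
  prescribed quadratic characters are used instead.

  The auxiliary polynomial does not vanish because products of \<open>d\<close>-th roots of distinct linear
  polynomials are linearly independent over the rational functions, in the quantitative form that a
  combination of them with coefficients of low degree cannot vanish to high order at a point.
\<close>

section \<open>Linear systems and roots of power series\<close>

text \<open>Radicals enter through \<open>N * d + 1 = q\<close>. If \<open>Y ^ d = x + a\<close>
  near a point \<open>c\<close> of the field with \<open>c + a \<noteq> 0\<close>, the
  \<open>d\<close>-th power of \<open>(x + a) ^ N * Y\<close> is \<open>(x + a) ^ q\<close>, which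
  is \<open>(x - c) ^ q + (c + a)\<close>. So \<open>(x + a) ^ N\<close> is a constant times
  \<open>1 / Y\<close> to order \<open>q\<close> at \<open>c\<close>, and a vanishing auxiliary
  polynomial yields a relation between radicals, but only to order \<open>q\<close>. A cofactor
  turns this relation into a polynomial \<open>R\<close> free of radicals and of degree below
  \<open>q\<close>; order \<open>q\<close> then forces \<open>R = 0\<close>, and the relation
  becomes exact. The obstacle is that exact relations cannot be excluded by looking at
  \<open>c\<close>, where all roots are unramified power series. Hence \<open>R\<close> is computed
  in the formal algebra of radical monomials, before any roots are chosen: the same \<open>R\<close>
  can be read at \<open>c\<close> and at the place above \<open>-b\<close>, where
  \<open>x + b\<close> ramifies and the powers of its root separate by their exponents modulo
  \<open>d\<close>.\<close>

lemma homogeneous_system_nontrivial_solution: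
  fixes a :: "'r \<Rightarrow> 'i \<Rightarrow> 'k::field"
  assumes "finite R" "finite I" "card R < card I"
  shows "\<exists>c. (\<exists>i\<in>I. c i \<noteq> 0) \<and> (\<forall>r\<in>R. (\<Sum>i\<in>I. a r i * c i) = 0)"
  using assms
proof (induction R arbitrary: I a rule: finite_induct)
  case empty
  then obtain i where "i \<in> I" by fastforce
  then show ?case by (intro exI[of _ "\<lambda>_. 1"]) auto
next
  case (insert r R)
  show ?case
  proof (cases "\<forall>i\<in>I. a r i = 0")
    case True
    have "card R < card I" using insert by simp
    then obtain c where "\<exists>i\<in>I. c i \<noteq> 0" "\<forall>r\<in>R. (\<Sum>i\<in>I. a r i * c i) = 0"
      using insert.IH[of I a] insert.prems by blast
    with True show ?thesis by (intro exI[of _ c]) auto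
  next
    case False
    then obtain j where j: "j \<in> I" "a r j \<noteq> 0" by auto
    define b where "b s i = a s i - a s j / a r j * a r i" for s i
    have "card R < card (I - {j})" using insert j by simp
    then obtain c where c: "\<exists>i\<in>I-{j}. c i \<noteq> 0" "\<forall>s\<in>R. (\<Sum>i\<in>I-{j}. b s i * c i) = 0"
      using insert.IH[of "I - {j}" b] insert.prems by auto
    define c' where "c' = c(j := - (\<Sum>i\<in>I-{j}. a r i * c i) / a r j)"
    have split: "(\<Sum>i\<in>I. a s i * c' i) = a s j * c' j + (\<Sum>i\<in>I-{j}. a s i * c i)" for s
      by (subst sum.remove[OF _ j(1)]) (use insert.prems in \<open>auto simp: c'_def intro!: sum.cong\<close>)
    have "(\<Sum>i\<in>I. a s i * c' i) = 0" if "s \<in> R" for s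
    proof -
      have "0 = (\<Sum>i\<in>I-{j}. a s i * c i) - a s j / a r j * (\<Sum>i\<in>I-{j}. a r i * c i)"
        using c(2) that by (simp add: b_def algebra_simps sum_subtractf sum_distrib_left)
      then show ?thesis unfolding split by (simp add: c'_def)
    qed
    moreover have "(\<Sum>i\<in>I. a r i * c' i) = 0"
      unfolding split using j by (simp add: c'_def)
    moreover have "\<exists>i\<in>I. c' i \<noteq> 0" using c(1) by (auto simp: c'_def)
    ultimately show ?thesis by (intro exI[of _ c']) auto
  qed
qed

text \<open>The unknowns are the \<open>card F * D\<close> coefficients of the \<open>P f\<close>;
  by \<open>deg\<close> the equation for \<open>h\<close> amounts to \<open>m h\<close> scalar ones.
  Both the radical-free multiple and Stepanov's polynomial are obtained this way.\<close>

lemma linear_polynomial_system_nontrivial_solution: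
  fixes T :: "'h \<Rightarrow> 'f \<Rightarrow> 'k::field poly \<Rightarrow> 'k poly"
  assumes fin: "finite F" "finite H"
    and add: "\<And>h f p q. T h f (p + q) = T h f p + T h f q"
    and smult: "\<And>h f c p. T h f (smult c p) = smult c (T h f p)"
    and deg: "\<And>h f p. h \<in> H \<Longrightarrow> f \<in> F \<Longrightarrow> degree p < D \<Longrightarrow> degree (T h f p) < m h"
    and less: "(\<Sum>h\<in>H. m h) < card F * D"
  shows "\<exists>P. (\<exists>f\<in>F. P f \<noteq> 0) \<and> (\<forall>f\<in>F. degree (P f) < D) \<and> (\<forall>h\<in>H. (\<Sum>f\<in>F. T h f (P f)) = 0)"
proof -
  define R where "R = (SIGMA h:H. {..<m h})"
  define I where "I = F \<times> {..<D}"
  have D: "D > 0" using less by (cases D) auto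
  have "card R < card I" "finite R" "finite I" using fin less by (auto simp: R_def I_def)
  from homogeneous_system_nontrivial_solution[OF this(2,3,1),
      of "\<lambda>(h, j) (f, i). coeff (T h f (monom 1 i)) j"]
  obtain c where c: "\<exists>i\<in>I. c i \<noteq> 0"
     "\<And>h j. (h, j) \<in> R \<Longrightarrow> (\<Sum>(f, i)\<in>I. coeff (T h f (monom 1 i)) j * c (f, i)) = 0"
    by (fastforce simp: case_prod_unfold)
  define P where "P f = (\<Sum>i<D. monom (c (f, i)) i)" for f
  have coeffP: "coeff (P f) i = (if i < D then c (f, i) else 0)" for f i
    by (auto simp: P_def coeff_sum if_distrib cong: if_cong)
  have degP: "degree (P f) < D" for f
    using D by (cases D) (auto intro!: degree_le simp: coeffP less_Suc_eq_le)
  have T0: "T h f 0 = 0" for h f using smult[of h f 0 0] by simp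
  have Tsum: "T h f (\<Sum>i\<in>J. g i) = (\<Sum>i\<in>J. T h f (g i))" if "finite J" for h f J and g :: "nat \<Rightarrow> 'k poly"
    using that by (induction J rule: finite_induct) (auto simp: T0 add)
  have TP: "T h f (P f) = (\<Sum>i<D. smult (c (f, i)) (T h f (monom 1 i)))" for h f
    unfolding P_def by (subst Tsum) (auto simp: smult[symmetric] smult_monom)
  have "(\<Sum>f\<in>F. T h f (P f)) = 0" if h: "h \<in> H" for h
  proof (rule poly_eqI)
    fix j
    show "coeff (\<Sum>f\<in>F. T h f (P f)) j = coeff 0 j"
    proof (cases "j < m h")
      case True
      have "coeff (\<Sum>f\<in>F. T h f (P f)) j = (\<Sum>f\<in>F. \<Sum>i<D. coeff (T h f (monom 1 i)) j * c (f, i))"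
        by (simp add: TP coeff_sum mult.commute)
      also have "\<dots> = (\<Sum>(f, i)\<in>I. coeff (T h f (monom 1 i)) j * c (f, i))"
        unfolding I_def using fin by (subst sum.cartesian_product) auto
      also have "\<dots> = 0" by (rule c(2)) (use h True in \<open>auto simp: R_def\<close>)
      finally show ?thesis by simp
    next
      case False
      have "coeff (T h f (P f)) j = 0" if "f \<in> F" for f
        using deg[OF h that degP[of f]] False by (intro coeff_eq_0) auto
      then show ?thesis by (simp add: coeff_sum)
    qed
  qed
  moreover have "\<exists>f\<in>F. P f \<noteq> 0"
  proof -
    from c(1) obtain f i where "f \<in> F" "i < D" "c (f, i) \<noteq> 0" by (auto simp: I_def)
    then have "coeff (P f) i \<noteq> 0" by (simp add: coeffP)
    with \<open>f \<in> F\<close> show ?thesis by force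
  qed
  ultimately show ?thesis using degP by blast
qed

text \<open>Hensel lifting from a root \<open>y0\<close> of the constant coefficient: the derivative
  \<open>d * y0 ^ (d - 1)\<close> is nonzero, so every further coefficient solves a linear
  equation.\<close>

lemma fps_nth_root_exists:
  fixes f :: "'k::alg_closed_field fps"
  assumes d: "of_nat d \<noteq> (0::'k)" and f0: "fps_nth f 0 \<noteq> 0"
  shows "\<exists>Y. Y ^ d = f"
proof -
  have d0: "d > 0" using d by (intro Nat.gr0I) auto
  obtain y0 where y0: "y0 ^ d = fps_nth f 0" using nth_root_exists[OF d0] by blast
  define m where "m = d - 1"
  have "y0 \<noteq> 0" using y0 f0 d0 by (auto simp: zero_power)
  define Q where "Q n Y \<longleftrightarrow> fps_nth Y 0 = y0 \<and> (\<forall>i\<le>n. fps_nth (Y ^ d) i = fps_nth f i)" for n and Y :: "'k fps"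
  have "\<exists>g. \<forall>n. Q n (g n) \<and> (\<forall>i\<le>n. fps_nth (g (Suc n)) i = fps_nth (g n) i)"
  proof (rule dependent_nat_choice)
    show "\<exists>Y. Q 0 Y"
      by (rule exI[of _ "fps_const y0"]) (auto simp: Q_def y0 fps_nth_power_0)
  next
    fix Y n assume Y: "Q n Y"
    \<comment> \<open>Newton correction: adding \<open>E\<close> changes the coefficient of index
      \<open>n + 1\<close> of \<open>Y ^ d\<close> by \<open>d * e * y0 ^ m\<close>; terms of second
      order in \<open>E\<close> start only at index \<open>2 * (n + 1)\<close>.\<close>
    define e where "e = (fps_nth f (Suc n) - fps_nth (Y ^ d) (Suc n)) / (of_nat d * y0 ^ m)"
    define E where "E = fps_const e * fps_X ^ Suc n"
    define Z where "Z = Y + E"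
    have "Z ^ d = (\<Sum>k\<le>d. of_nat (d choose k) * E ^ k * Y ^ (d - k))"
      unfolding Z_def by (subst add.commute) (rule binomial_ring)
    also have "{..d} = insert 0 (insert 1 {2..d})" using d0 by auto
    also have "(\<Sum>k\<in>\<dots>. of_nat (d choose k) * E ^ k * Y ^ (d - k)) =
        Y ^ d + of_nat d * E * Y ^ m + (\<Sum>k\<in>{2..d}. of_nat (d choose k) * E ^ k * Y ^ (d - k))"
      by (simp add: m_def)
    finally have Zd: "Z ^ d = \<dots>" .
    have tail: "fps_nth (\<Sum>k\<in>{2..d}. of_nat (d choose k) * E ^ k * Y ^ (d - k)) i = 0" if "i \<le> Suc n" for i
    proof -
      have "fps_nth (of_nat (d choose k) * E ^ k * Y ^ (d - k)) i = 0" if "k \<ge> 2" for k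
      proof -
        have eq: "of_nat (d choose k) * E ^ k * Y ^ (d - k) =
            fps_X ^ (Suc n * k) * (of_nat (d choose k) * fps_const e ^ k * Y ^ (d - k))"
        proof -
          have "E ^ k = fps_const e ^ k * fps_X ^ (Suc n * k)"
            by (simp only: E_def power_mult_distrib power_mult)
          then show ?thesis by (simp only: mult_ac)
        qed
        have "Suc n * k \<ge> Suc n * 2" using that by (rule mult_le_mono2)
        moreover have "i < Suc n * 2" using \<open>i \<le> Suc n\<close> by simp
        ultimately have "i < Suc n * k" by (rule order.strict_trans2[rotated])
        then show ?thesis unfolding eq by (simp add: fps_X_power_mult_nth)
      qed
      then show ?thesis by (auto simp: fps_sum_nth intro!: sum.neutral)
    qed
    have mid: "fps_nth (of_nat d * E * Y ^ m) i =
        (if i < Suc n then 0 else fps_nth (of_nat d * fps_const e * Y ^ m) (i - Suc n))" for i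
    proof -
      have "of_nat d * E * Y ^ m = fps_X ^ (Suc n) * (of_nat d * fps_const e * Y ^ m)"
        by (simp only: E_def mult_ac)
      then show ?thesis by (simp only: fps_X_power_mult_nth)
    qed
    have "fps_nth (Z ^ d) i = fps_nth f i" if "i \<le> Suc n" for i
    proof (cases "i = Suc n")
      case False
      then show ?thesis using that Y unfolding Zd by (auto simp: mid tail Q_def)
    next
      case True
      have "fps_nth (of_nat d * fps_const e * Y ^ m) 0 = of_nat d * e * y0 ^ m"
        using Y by (auto simp: Q_def fps_nth_power_0)
      then have "fps_nth (Z ^ d) i = fps_nth (Y ^ d) (Suc n) + of_nat d * e * y0 ^ m"
        unfolding Zd using True by (simp add: mid tail del: fps_mult_nth_0)
      also have "\<dots> = fps_nth f i" using d \<open>y0 \<noteq> 0\<close> True by (simp add: e_def)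
      finally show ?thesis .
    qed
    moreover have "fps_nth Z i = fps_nth Y i" if "i \<le> n" for i
      using that by (simp add: Z_def E_def fps_X_power_mult_right_nth del: power_Suc)
    moreover have "fps_nth Z 0 = y0" using calculation(2)[of 0] Y by (simp add: Q_def)
    ultimately show "\<exists>Z. Q (Suc n) Z \<and> (\<forall>i\<le>n. fps_nth Z i = fps_nth Y i)"
      by (intro exI[of _ Z]) (auto simp: Q_def)
  qed
  then obtain g where g: "\<And>n. Q n (g n)" "\<And>n i. i \<le> n \<Longrightarrow> fps_nth (g (Suc n)) i = fps_nth (g n) i"
    by blast
  have stable: "fps_nth (g (n + k)) i = fps_nth (g n) i" if "i \<le> n" for n k i
    using that by (induction k) (auto simp: g(2))
  define Y where "Y = Abs_fps (\<lambda>n. fps_nth (g n) n)"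
  have Y: "fps_nth Y i = fps_nth (g n) i" if "i \<le> n" for i n
    using stable[of i i "n - i"] that by (simp add: Y_def)
  have pow: "fps_nth (Y ^ k) i = fps_nth (g n ^ k) i" if "i \<le> n" for i n k
    using that
  proof (induction k arbitrary: i)
    case (Suc k)
    then show ?case by (auto simp: fps_mult_nth Y[of _ n] intro!: sum.cong)
  qed auto
  have "Y ^ d = f"
    by (rule fps_ext) (use pow[OF order.refl] g(1) in \<open>auto simp: Q_def\<close>)
  then show ?thesis by blast
qed

section \<open>Independence of Kummer radicals\<close>

definition exponents :: "nat \<Rightarrow> 'a set \<Rightarrow> ('a \<Rightarrow> nat) set" where
  "exponents d A = (\<Pi>\<^sub>E a\<in>A. {..<d})"

definition power_prod :: "'a set \<Rightarrow> ('a \<Rightarrow> 'r::comm_monoid_mult) \<Rightarrow> ('a \<Rightarrow> nat) \<Rightarrow> 'r" where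
  "power_prod A Y e = (\<Prod>a\<in>A. Y a ^ e a)"

definition add_exponents :: "nat \<Rightarrow> 'a set \<Rightarrow> ('a \<Rightarrow> nat) \<Rightarrow> ('a \<Rightarrow> nat) \<Rightarrow> 'a \<Rightarrow> nat" where
  "add_exponents d A e f = (\<lambda>a\<in>A. (e a + f a) mod d)"

text \<open>Structure constants of the algebra generated over the polynomials by \<open>d\<close>-th
  roots of the \<open>x + a\<close>, in the basis of radical monomials: each exponent that overflows
  \<open>d\<close> releases one factor \<open>x + a\<close>.\<close>

definition carry :: "nat \<Rightarrow> 'k set \<Rightarrow> ('k \<Rightarrow> nat) \<Rightarrow> ('k \<Rightarrow> nat) \<Rightarrow> 'k::comm_ring_1 poly" where
  "carry d A e f = (\<Prod>a\<in>A. if d \<le> e a + f a then [:a, 1:] else 1)"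

definition is_ring_hom :: "('r::ring_1 \<Rightarrow> 's::ring_1) \<Rightarrow> bool" where
  "is_ring_hom \<psi> \<longleftrightarrow> \<psi> 1 = 1 \<and> (\<forall>x y. \<psi> (x + y) = \<psi> x + \<psi> y \<and> \<psi> (x * y) = \<psi> x * \<psi> y)"

lemma is_ring_homD:
  assumes "is_ring_hom \<psi>"
  shows "\<psi> 1 = 1" "\<psi> 0 = 0" "\<psi> (x + y) = \<psi> x + \<psi> y" "\<psi> (x * y) = \<psi> x * \<psi> y"
proof -
  have "\<psi> (0 + 0) = \<psi> 0 + \<psi> 0" using assms unfolding is_ring_hom_def by blast
  then show "\<psi> 0 = 0" by simp
qed (use assms in \<open>auto simp: is_ring_hom_def\<close>)

lemma is_ring_hom_sum: "is_ring_hom \<psi> \<Longrightarrow> \<psi> (\<Sum>i\<in>I. f i) = (\<Sum>i\<in>I. \<psi> (f i))"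
  by (induction I rule: infinite_finite_induct) (auto simp: is_ring_homD)

lemma is_ring_hom_prod:
  fixes \<psi> :: "'r::comm_ring_1 \<Rightarrow> 's::comm_ring_1"
  shows "is_ring_hom \<psi> \<Longrightarrow> \<psi> (\<Prod>i\<in>I. f i) = (\<Prod>i\<in>I. \<psi> (f i))"
  by (induction I rule: infinite_finite_induct) (auto simp: is_ring_homD)

lemma finite_exponents [simp]: "finite A \<Longrightarrow> finite (exponents d A)"
  by (simp add: exponents_def finite_PiE)

lemma card_exponents: "finite A \<Longrightarrow> card (exponents d A) = d ^ card A"
  by (simp add: exponents_def card_PiE)

lemma add_exponents_mem: "d > 0 \<Longrightarrow> add_exponents d A e f \<in> exponents d A"
  by (auto simp: add_exponents_def exponents_def)

lemma power_prod_mult: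
  fixes \<psi> :: "'k::comm_ring_1 poly \<Rightarrow> 'r::comm_ring_1"
  assumes \<psi>: "is_ring_hom \<psi>" and Y: "\<And>a. a \<in> A \<Longrightarrow> Y a ^ d = \<psi> [:a, 1:]"
    and e: "e \<in> exponents d A" "f \<in> exponents d A"
  shows "power_prod A Y e * power_prod A Y f = \<psi> (carry d A e f) * power_prod A Y (add_exponents d A e f)"
proof -
  have "Y a ^ e a * Y a ^ f a = \<psi> (if d \<le> e a + f a then [:a, 1:] else 1) * Y a ^ ((e a + f a) mod d)"
    if "a \<in> A" for a
  proof -
    have lt: "e a < d" "f a < d" using e that by (auto simp: exponents_def)
    show ?thesis
    proof (cases "d \<le> e a + f a")
      case True
      have "(e a + f a) mod d = e a + f a - d" using True lt
        by (subst le_mod_geq) auto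
      then have "e a + f a = d + (e a + f a) mod d" using True by simp
      then have "Y a ^ e a * Y a ^ f a = Y a ^ d * Y a ^ ((e a + f a) mod d)"
        by (metis power_add)
      then show ?thesis using True Y that by simp
    next
      case False
      then show ?thesis by (simp add: is_ring_homD[OF \<psi>] flip: power_add)
    qed
  qed
  then show ?thesis
    by (simp add: power_prod_def carry_def is_ring_hom_prod[OF \<psi>] add_exponents_def flip: prod.distrib)
qed

lemma degree_carry_le:
  assumes "finite A" shows "degree (carry d A e f) \<le> card A"
proof -
  have "degree (carry d A e f) \<le> (\<Sum>a\<in>A. degree (if d \<le> e a + f a then [:a, 1:] else 1))"
    unfolding carry_def by (rule order.trans[OF degree_prod_sum_le[OF assms]]) simp
  also have "\<dots> \<le> (\<Sum>a\<in>A. 1)" by (rule sum_mono) auto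
  finally show ?thesis by simp
qed

text \<open>
  The multiple \<open>R\<close> free of the radicals plays the role of the norm; counting unknowns yields it
  without conjugates.
\<close>
lemma bounded_degree_multiple:
  fixes A :: "'k::field set"
  assumes fin: "finite A" and d: "d > 0" and D: "\<And>e. e \<in> exponents d A \<Longrightarrow> degree (P e) < D"
  shows "\<exists>W R. (\<exists>e\<in>exponents d A. W e \<noteq> 0) \<and> degree R \<le> d ^ card A * (D + card A) \<and>
    (\<forall>(\<psi> :: 'k poly \<Rightarrow> 'r::comm_ring_1) Y. is_ring_hom \<psi> \<longrightarrow> (\<forall>a\<in>A. Y a ^ d = \<psi> [:a, 1:]) \<longrightarrow>
       (\<Sum>e\<in>exponents d A. \<psi> (P e) * power_prod A Y e) *
       (\<Sum>e\<in>exponents d A. \<psi> (W e) * power_prod A Y e) = \<psi> R)"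
proof -
  let ?E = "exponents d A" and ?k = "card A"
  define J where "J = d ^ ?k"
  define z where "z = (\<lambda>a\<in>A. 0::nat)"
  have z: "z \<in> ?E" using d by (auto simp: z_def exponents_def)
  have J: "card ?E = J" "J > 0" using fin d by (auto simp: card_exponents J_def)
  \<comment> \<open>\<open>T h f (W f)\<close> is what \<open>W f\<close> times the monomial
    \<open>f\<close> contributes to the monomial \<open>h\<close> in the product with the
    combination of the \<open>P e\<close>.\<close>
  define T where "T h f p = (\<Sum>e | e \<in> ?E \<and> add_exponents d A e f = h. P e * carry d A e f) * p" for h f p
  \<comment> \<open>The least bound for which the count works: all monomials except the trivial one
    \<open>z\<close> are to cancel, which gives \<open>(J - 1) * (D' + D + card A)\<close> equations
    against \<open>J * D'\<close> unknowns.\<close>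
  define D' where "D' = (J - 1) * (D + ?k) + 1"
  have degT: "degree (T h f p) < D' + D + ?k" if "degree p < D'" for h f p
  proof -
    have "degree (\<Sum>e | e \<in> ?E \<and> add_exponents d A e f = h. P e * carry d A e f) \<le> D + ?k"
    proof (rule degree_sum_le)
      fix e assume e: "e \<in> {e \<in> ?E. add_exponents d A e f = h}"
      have "degree (P e * carry d A e f) \<le> degree (P e) + degree (carry d A e f)"
        by (rule degree_mult_le)
      also have "\<dots> \<le> D + ?k" using D[of e] e degree_carry_le[OF fin, of d e f] by auto
      finally show "degree (P e * carry d A e f) \<le> D + ?k" .
    qed (use fin in auto)
    then have "degree (T h f p) \<le> D + ?k + degree p"
      unfolding T_def by (meson degree_mult_le order.trans add_mono order.refl)
    then show ?thesis using that by simp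
  qed
  have cardH: "card (?E - {z}) = J - 1" using z J fin by simp
  have "(J - 1) * (D' + (D + ?k)) < J * D'"
  proof -
    obtain j where "J = Suc j" using J(2) by (cases J) auto
    then show ?thesis by (simp add: D'_def algebra_simps)
  qed
  then have less: "(\<Sum>h\<in>?E - {z}. D' + D + ?k) < card ?E * D'"
    using cardH J(1) by (simp add: add.assoc)
  have "\<exists>W. (\<exists>f\<in>?E. W f \<noteq> 0) \<and> (\<forall>f\<in>?E. degree (W f) < D') \<and> (\<forall>h\<in>?E - {z}. (\<Sum>f\<in>?E. T h f (W f)) = 0)"
    by (rule linear_polynomial_system_nontrivial_solution[OF _ _ _ _ _ less])
       (use fin degT in \<open>auto simp: T_def distrib_left\<close>)
  then obtain W where W: "\<exists>f\<in>?E. W f \<noteq> 0" "\<And>f. f \<in> ?E \<Longrightarrow> degree (W f) < D'"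
      "\<And>h. h \<in> ?E - {z} \<Longrightarrow> (\<Sum>f\<in>?E. T h f (W f)) = 0" by blast
  define R where "R = (\<Sum>f\<in>?E. T z f (W f))"
  have "degree R \<le> D' - 1 + D + ?k"
    unfolding R_def
  proof (rule degree_sum_le)
    fix f assume "f \<in> ?E"
    then show "degree (T z f (W f)) \<le> D' - 1 + D + ?k" using degT[OF W(2), of f z f] by (simp add: D'_def)
  qed (use fin in auto)
  also have "\<dots> = J * (D + ?k)"
  proof -
    obtain j where "J = Suc j" using J(2) by (cases J) auto
    then show ?thesis by (simp add: D'_def algebra_simps)
  qed
  finally have degR: "degree R \<le> d ^ ?k * (D + ?k)" by (simp add: J_def)
  have "(\<Sum>e\<in>?E. \<psi> (P e) * power_prod A Y e) * (\<Sum>e\<in>?E. \<psi> (W e) * power_prod A Y e) = \<psi> R"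
    if \<psi>: "is_ring_hom \<psi>" and Y: "\<forall>a\<in>A. Y a ^ d = \<psi> [:a, 1:]" for \<psi> :: "'k poly \<Rightarrow> 'r" and Y
  proof -
    note hom = is_ring_homD[OF \<psi>] is_ring_hom_sum[OF \<psi>]
    have "(\<Sum>e\<in>?E. \<psi> (P e) * power_prod A Y e) * (\<Sum>f\<in>?E. \<psi> (W f) * power_prod A Y f) =
        (\<Sum>f\<in>?E. \<Sum>e\<in>?E. \<psi> (P e) * \<psi> (W f) * (power_prod A Y e * power_prod A Y f))"
      by (subst sum.swap) (simp add: sum_product mult_ac)
    also have "\<dots> = (\<Sum>f\<in>?E. \<Sum>e\<in>?E. \<psi> (P e * carry d A e f * W f) * power_prod A Y (add_exponents d A e f))"
      using Y by (intro sum.cong refl) (subst power_prod_mult[OF \<psi>], auto simp: hom mult_ac)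
    also have "\<dots> = (\<Sum>f\<in>?E. \<Sum>h\<in>?E. \<Sum>e | e \<in> ?E \<and> add_exponents d A e f = h.
        \<psi> (P e * carry d A e f * W f) * power_prod A Y (add_exponents d A e f))"
      using fin d by (intro sum.cong refl sum.group[symmetric]) (auto simp: add_exponents_mem)
    also have "\<dots> = (\<Sum>f\<in>?E. \<Sum>h\<in>?E. \<psi> (T h f (W f)) * power_prod A Y h)"
      by (intro sum.cong refl) (auto simp: T_def hom sum_distrib_right intro!: sum.cong)
    also have "\<dots> = (\<Sum>h\<in>?E. \<psi> (\<Sum>f\<in>?E. T h f (W f)) * power_prod A Y h)"
      by (subst sum.swap) (simp add: hom sum_distrib_right)
    also have "\<dots> = \<psi> R * power_prod A Y z"
      using z fin W(3) by (subst sum.remove[of _ z]) (auto simp: R_def hom intro!: sum.neutral)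
    also have "power_prod A Y z = 1" by (simp add: power_prod_def z_def)
    finally show ?thesis by simp
  qed
  with W(1) degR show ?thesis by blast
qed

section \<open>Power series expansions and linear independence of radicals\<close>

definition taylor_fps :: "'k::comm_ring_1 \<Rightarrow> 'k poly \<Rightarrow> 'k fps" where
  "taylor_fps c p = fps_of_poly (pcompose p [:c, 1:])"

lemma is_ring_hom_fps_of_poly_pcompose: "is_ring_hom (\<lambda>p. fps_of_poly (pcompose p (q :: 'k::comm_ring_1 poly)))"
  by (auto simp: is_ring_hom_def pcompose_add pcompose_mult pcompose_1 fps_of_poly_add fps_of_poly_mult)

lemma is_ring_hom_taylor_fps: "is_ring_hom (taylor_fps c)"
  unfolding taylor_fps_def by (rule is_ring_hom_fps_of_poly_pcompose)

lemma taylor_fps_linear: "taylor_fps c [:a, 1:] = fps_of_poly [:c + a, 1:]"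
  by (simp add: taylor_fps_def pcompose_pCons add.commute)

lemma taylor_fps_eq_0_iff [simp]: "taylor_fps c (p :: 'k::idom poly) = 0 \<longleftrightarrow> p = 0"
proof -
  have "pcompose p [:c, 1:] = 0 \<longleftrightarrow> p = 0" by (auto simp: pcompose_eq_0_iff dest: pcompose_eq_0)
  then show ?thesis by (simp add: taylor_fps_def)
qed

lemma sum_exponents_insert:
  assumes "finite A" "b \<notin> A"
  shows "(\<Sum>e\<in>exponents d (insert b A). F e) = (\<Sum>j<d. \<Sum>g\<in>exponents d A. F (g(b := j)))"
proof -
  have "exponents d (insert b A) = (\<lambda>(j, g). g(b := j)) ` ({..<d} \<times> exponents d A)"
    by (simp add: exponents_def PiE_insert_eq)
  moreover have "inj_on (\<lambda>(j, g). g(b := j)) ({..<d} \<times> exponents d A)"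
    using inj_combinator[OF assms(2), of "\<lambda>_. {..<d}"] by (simp add: exponents_def)
  ultimately show ?thesis
    by (simp add: sum.reindex sum.cartesian_product case_prod_unfold)
qed

text \<open>The summands have disjoint supports: \<open>fps_X ^ j * (G j oo fps_X ^ d)\<close> only
  has exponents congruent to \<open>j\<close> modulo \<open>d\<close>.\<close>

lemma fps_residue_classes_eq_0:
  fixes G :: "nat \<Rightarrow> 'k::comm_ring_1 fps"
  assumes "(\<Sum>j<d. fps_X ^ j * (G j oo fps_X ^ d)) = 0" and j: "j < d"
  shows "G j = 0"
proof (rule fps_ext)
  fix m
  have "0 = fps_nth (\<Sum>i<d. fps_X ^ i * (G i oo fps_X ^ d)) (d * m + j)" using assms by simp
  also have "\<dots> = (\<Sum>i<d. if i = j then fps_nth (G j) m else 0)"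
    unfolding fps_sum_nth
  proof (rule sum.cong[OF refl])
    fix i assume i: "i \<in> {..<d}"
    have "i = j" if "i \<le> d * m + j" "d dvd d * m + j - i"
    proof -
      have "(d * m + j) mod d = i mod d" using that by (subst mod_eq_dvd_iff_nat)
      then show ?thesis using i j by simp
    qed
    then show "fps_nth (fps_X ^ i * (G i oo fps_X ^ d)) (d * m + j) = (if i = j then fps_nth (G j) m else 0)"
      using j by (auto simp: fps_X_power_mult_nth fps_nth_compose_X_power)
  qed
  also have "\<dots> = fps_nth (G j) m" using j by simp
  finally show "fps_nth (G j) m = fps_nth 0 m" by simp
qed

text \<open>
  The last root is adjoined at the place above \<open>x = -b\<close>, where the local parameter \<open>\<tau>\<close> satisfies
  \<open>\<tau>^d = x + b\<close>: the other roots are power series in \<open>\<tau>^d\<close> there, so the powers of \<open>\<tau>\<close> separate.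
\<close>
lemma kummer_independent:
  fixes A :: "'k::alg_closed_field set"
  assumes fin: "finite A" and d: "of_nat d \<noteq> (0::'k)"
    and "\<And>a. a \<in> A \<Longrightarrow> c + a \<noteq> 0" and "\<And>a. a \<in> A \<Longrightarrow> Y a ^ d = taylor_fps c [:a, 1:]"
    and "(\<Sum>e\<in>exponents d A. taylor_fps c (P e) * power_prod A Y e) = 0"
  shows "\<forall>e\<in>exponents d A. P e = 0"
  using fin assms(3-)
proof (induction A arbitrary: c Y P rule: finite_induct)
  case empty
  then show ?case by (simp add: exponents_def power_prod_def)
next
  case (insert b A)
  let ?E = "exponents d (insert b A)"
  have d0: "d > 0" using d by (intro Nat.gr0I) auto
  have "\<exists>Z. \<forall>a\<in>A. Z a ^ d = taylor_fps (-b) [:a, 1:]"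
  proof (rule bchoice, rule ballI)
    fix a assume "a \<in> A"
    then have "a \<noteq> b" using insert by auto
    then show "\<exists>Z. Z ^ d = taylor_fps (-b) [:a, 1:]"
      by (intro fps_nth_root_exists d) (simp add: taylor_fps_linear)
  qed
  then obtain Z where Z: "\<And>a. a \<in> A \<Longrightarrow> Z a ^ d = taylor_fps (-b) [:a, 1:]" by blast
  define \<psi> where "\<psi> p = fps_of_poly (pcompose p ([:-b:] + monom 1 d))" for p :: "'k poly"
  have \<psi>_hom: "is_ring_hom \<psi>" unfolding \<psi>_def by (rule is_ring_hom_fps_of_poly_pcompose)
  have \<psi>: "\<psi> p = taylor_fps (-b) p oo fps_X ^ d" for p
  proof -
    have "pcompose p ([:-b:] + monom 1 d) = pcompose (pcompose p [:-b, 1:]) (monom 1 d)"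
      by (simp add: pcompose_pCons flip: pcompose_assoc)
    then show ?thesis unfolding \<psi>_def taylor_fps_def
      using d0 by (simp add: fps_of_poly_pcompose fps_of_poly_monom)
  qed
  define Y' where "Y' = (\<lambda>a. Z a oo fps_X ^ d)(b := fps_X)"
  have X0: "fps_nth (fps_X ^ d :: 'k fps) 0 = 0" using d0 by simp
  have Y': "Y' a ^ d = \<psi> [:a, 1:]" if "a \<in> insert b A" for a
  proof (cases "a = b")
    case True
    then show ?thesis
      by (simp add: Y'_def \<psi>_def pcompose_pCons fps_of_poly_monom fps_of_poly_add fps_of_poly_diff)
  next
    case False
    then show ?thesis using that Z[of a] by (simp add: Y'_def \<psi> fps_compose_power[OF X0])
  qed
  have indep: "\<forall>e\<in>?E. Q e = 0" if "(\<Sum>e\<in>?E. \<psi> (Q e) * power_prod (insert b A) Y' e) = 0" for Q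
  proof -
    \<comment> \<open>\<open>G j\<close> collects the terms with exponent \<open>j\<close> at
      \<open>b\<close>. Its vanishing is a relation between the other roots at the point
      \<open>-b\<close>, where they are unramified; this is why the induction runs over all
      \<open>c\<close>.\<close>
    define G where "G j = (\<Sum>g\<in>exponents d A. taylor_fps (-b) (Q (g(b := j))) * power_prod A Z g)" for j
    have "power_prod (insert b A) Y' (g(b := j)) = fps_X ^ j * (power_prod A Z g oo fps_X ^ d)" for g j
    proof -
      have "power_prod (insert b A) Y' (g(b := j)) = fps_X ^ j * (\<Prod>a\<in>A. (Z a oo fps_X ^ d) ^ g a)"
        unfolding power_prod_def using insert.hyps
        by (subst prod.insert) (auto simp: Y'_def intro!: prod.cong)
      then show ?thesis
        by (simp add: power_prod_def fps_compose_prod_distrib[OF X0] fps_compose_power[OF X0])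
    qed
    then have "(\<Sum>j<d. fps_X ^ j * (G j oo fps_X ^ d)) = 0"
      using that unfolding sum_exponents_insert[OF insert.hyps] G_def
      by (simp add: \<psi> fps_compose_sum_distrib fps_compose_mult_distrib[OF X0] sum_distrib_left mult_ac)
    then have G0: "G j = 0" if "j < d" for j using fps_residue_classes_eq_0 that by blast
    have Q0: "Q (g(b := j)) = 0" if "j < d" "g \<in> exponents d A" for g j
    proof -
      have "-b + a \<noteq> 0" if "a \<in> A" for a using that insert.hyps by auto
      then have "\<forall>g\<in>exponents d A. Q (g(b := j)) = 0"
        using insert.IH[of "-b" Z "\<lambda>g. Q (g(b := j))"] Z G0[OF \<open>j < d\<close>] unfolding G_def by blast
      then show ?thesis using that by blast
    qed
    have "?E = (\<lambda>(j, g). g(b := j)) ` ({..<d} \<times> exponents d A)"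
      by (simp add: exponents_def PiE_insert_eq)
    then show ?thesis using Q0 by auto
  qed
  have "finite ((\<lambda>e. degree (P e)) ` ?E)" using insert.hyps by simp
  then obtain D where D: "\<And>e. e \<in> ?E \<Longrightarrow> degree (P e) < D"
    by (auto simp: finite_nat_set_iff_bounded)
  have "\<exists>W R. (\<exists>e\<in>?E. W e \<noteq> 0) \<and> degree R \<le> d ^ card (insert b A) * (D + card (insert b A)) \<and>
    (\<forall>(\<psi> :: 'k poly \<Rightarrow> 'k fps) Y. is_ring_hom \<psi> \<longrightarrow> (\<forall>a\<in>insert b A. Y a ^ d = \<psi> [:a, 1:]) \<longrightarrow>
       (\<Sum>e\<in>?E. \<psi> (P e) * power_prod (insert b A) Y e) *
       (\<Sum>e\<in>?E. \<psi> (W e) * power_prod (insert b A) Y e) = \<psi> R)"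
    using insert.hyps by (intro bounded_degree_multiple d0 D) auto
  then obtain W R where W: "\<exists>e\<in>?E. W e \<noteq> 0" and R:
    "\<And>(\<psi> :: 'k poly \<Rightarrow> 'k fps) Y. is_ring_hom \<psi> \<Longrightarrow> \<forall>a\<in>insert b A. Y a ^ d = \<psi> [:a, 1:] \<Longrightarrow>
       (\<Sum>e\<in>?E. \<psi> (P e) * power_prod (insert b A) Y e) *
       (\<Sum>e\<in>?E. \<psi> (W e) * power_prod (insert b A) Y e) = \<psi> R"
    by blast
  \<comment> \<open>The transfer between places: \<open>R\<close> vanishes because its first factor
    does in the expansion at \<open>c\<close>. As \<open>R\<close> does not depend on the roots, the
    product vanishes at the ramified place too; there the factor with \<open>W\<close> is nonzero by
    \<open>indep\<close>, so the factor with \<open>P\<close> is zero.\<close>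
  have "taylor_fps c R = 0"
    using R[OF is_ring_hom_taylor_fps, of Y c] insert.prems(2,3) by simp
  then have "R = 0" by simp
  then have "\<psi> R = 0" by (simp add: is_ring_homD[OF \<psi>_hom])
  moreover have "(\<Sum>e\<in>?E. \<psi> (W e) * power_prod (insert b A) Y' e) \<noteq> 0" using indep W by blast
  ultimately have "(\<Sum>e\<in>?E. \<psi> (P e) * power_prod (insert b A) Y' e) = 0"
    using R[OF \<psi>_hom, of Y'] Y' by simp
  then show ?case by (rule indep)
qed

section \<open>Nonvanishing of the auxiliary polynomial\<close>

lemma dvd_diff_prod:
  fixes m :: "'r::comm_ring_1"
  assumes "\<And>a. a \<in> A \<Longrightarrow> m dvd f a - g a"
  shows "m dvd (\<Prod>a\<in>A. f a) - (\<Prod>a\<in>A. g a)"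
  using assms
proof (induction A rule: infinite_finite_induct)
  case (insert a A)
  have "f a * prod f A - g a * prod g A = (f a - g a) * prod f A + g a * (prod f A - prod g A)"
    by (simp add: algebra_simps)
  then show ?case using insert by simp
qed auto

lemma dvd_diff_power:
  fixes m :: "'r::comm_ring_1"
  assumes "m dvd x - y" shows "m dvd x ^ n - y ^ n"
  using dvd_diff_prod[of "{..<n}" m "\<lambda>_. x" "\<lambda>_. y"] assms by simp

lemma dvd_diff_mult:
  fixes m :: "'r::comm_ring_1"
  assumes "m dvd x - y" "m dvd z - w" shows "m dvd x * z - y * w"
proof -
  have "x * z - y * w = (x - y) * z + y * (z - w)" by (simp add: algebra_simps)
  then show ?thesis using assms by simp
qed

lemma fps_X_power_dvd_imp_nth_eq_0:
  fixes f :: "'k::comm_ring_1 fps"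
  assumes "fps_X ^ q dvd f" "i < q" shows "fps_nth f i = 0"
  using assms by (auto simp: fps_X_power_mult_nth elim!: dvdE)

text \<open>With \<open>\<mu>\<close> the constant coefficient of \<open>W\<close>,
  \<open>fps_X ^ q = W ^ d - \<mu> ^ d = (W - \<mu>) * V\<close>. The constant coefficient of
  \<open>V\<close> is \<open>d * \<mu> ^ (d - 1)\<close>, so \<open>V\<close> is a unit and the
  whole power of \<open>fps_X\<close> falls on \<open>W - \<mu>\<close>.\<close>

lemma fps_X_power_dvd_diff_const:
  fixes W :: "'k::field fps"
  assumes d: "of_nat d \<noteq> (0::'k)" and q: "q > 0" and m: "m \<noteq> 0"
    and W: "W ^ d = fps_X ^ q + fps_const m"
  shows "fps_X ^ q dvd W - fps_const (fps_nth W 0)" and "fps_nth W 0 \<noteq> 0"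
proof -
  define \<mu> where "\<mu> = fps_nth W 0"
  have d0: "d > 0" using d by (intro Nat.gr0I) auto
  have "\<mu> ^ d = fps_nth (W ^ d) 0" by (simp add: fps_nth_power_0 \<mu>_def)
  also have "\<dots> = m" using q unfolding W by simp
  finally have \<mu>d: "\<mu> ^ d = m" .
  then show "fps_nth W 0 \<noteq> 0" using m d0 by (auto simp: \<mu>_def zero_power)
  define V where "V = (\<Sum>i<d. fps_const \<mu> ^ (d - Suc i) * W ^ i)"
  have "fps_X ^ q = W ^ d - fps_const \<mu> ^ d" using W \<mu>d by simp
  also have "\<dots> = (W - fps_const \<mu>) * V" unfolding V_def by (rule power_diff_sumr2)
  finally have eq: "fps_X ^ q = (W - fps_const \<mu>) * V" .
  have "fps_nth V 0 = (\<Sum>i<d. \<mu> ^ (d - Suc i) * \<mu> ^ i)"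
    by (simp add: V_def fps_sum_nth fps_nth_power_0 \<mu>_def)
  also have "\<dots> = (\<Sum>i<d. \<mu> ^ (d - 1))"
    by (intro sum.cong) (auto simp flip: power_add)
  also have "\<dots> \<noteq> 0" using d \<mu>d m d0 by (auto simp: zero_power)
  finally have "V dvd 1" by (simp add: fps_is_unit_iff)
  then have "fps_X ^ q * 1 dvd (W - fps_const \<mu>)"
    by (metis eq dvd_div_mult dvd_mult_cancel_right is_unit_mult_iff dvd_refl mult_unit_dvd_iff mult.right_neutral)
  then show "fps_X ^ q dvd W - fps_const (fps_nth W 0)" by (simp add: \<mu>_def)
qed

text \<open>The field of \<open>q\<close> elements is taken as the fixed points of
  \<open>x \<mapsto> x ^ q\<close> in an algebraically closed field, so that power series with
  nonzero constant coefficient have \<open>d\<close>-th roots.\<close>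

locale power_residues =
  fixes K :: "'k::alg_closed_field set" and q d N n :: nat
  assumes K_def: "K = {x. x ^ q = x}" and card_K: "card K = q"
    and prime_CHAR: "prime CHAR('k)" and q_eq: "q = CHAR('k) ^ n"
    and d: "d \<ge> 2" and q: "q = d * N + 1" and N: "N > 0"
begin

lemma of_nat_d: "of_nat d \<noteq> (0::'k)"
proof
  assume "of_nat d = (0::'k)"
  then have "of_nat q = (1::'k)" by (simp add: q)
  moreover have "of_nat q = (0::'k)"
  proof -
    have "n > 0" using q_eq q d N by (intro Nat.gr0I) auto
    then show ?thesis by (simp add: q_eq)
  qed
  ultimately show False by simp
qed

lemma frobenius_linear_poly:
  assumes "a \<in> K" shows "[:a, 1:] ^ q = monom 1 q + [:a:]"
proof -
  have "([:0, 1:] + [:a:]) ^ q = [:0, 1:] ^ q + [:a:] ^ q"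
    by (rule freshmans_dream'[where n = n]) (simp_all add: prime_CHAR q_eq)
  also have "[:0, 1:] ^ q = monom (1::'k) q" by (simp add: monom_altdef)
  also have "[:a:] ^ q = [:a ^ q:]" by (simp add: poly_const_pow)
  finally show ?thesis using assms by (simp add: K_def)
qed

lemma uminus_mem_K: "c \<in> K \<Longrightarrow> - c \<in> K"
proof -
  assume c: "c \<in> K"
  have "(c + - c) ^ q = c ^ q + (- c) ^ q"
    by (rule freshmans_dream'[where n = n]) (simp_all add: prime_CHAR q_eq)
  then have "c ^ q + (- c) ^ q = 0" using q by (simp add: zero_power)
  then show "- c \<in> K" using c by (simp add: K_def eq_neg_iff_add_eq_0 add.commute)
qed

text \<open>Modulo \<open>fps_X ^ q\<close> the polynomial becomes a combination of the roots
  \<open>Y a\<close>. Its multiple \<open>R\<close> is divisible by \<open>fps_X ^ q\<close> and has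
  degree below \<open>q\<close> by \<open>small\<close>, hence is zero;
  \<open>kummer_independent\<close> shows the cofactor to be nonzero and then the coefficients to be
  zero.\<close>

lemma nonvanishing_at_point:
  assumes A: "finite A" "A \<subseteq> K" and c: "c \<in> K" "\<And>a. a \<in> A \<Longrightarrow> c + a \<noteq> 0"
    and D: "\<And>e. e \<in> exponents d A \<Longrightarrow> degree (P e) < D"
    and small: "d ^ card A * (D + card A) < q"
    and dvd: "[:-c, 1:] ^ q dvd (\<Sum>e\<in>exponents d A. P e * (\<Prod>a\<in>A. [:a, 1:] ^ (N * e a)))"
  shows "\<forall>e\<in>exponents d A. P e = 0"
proof -
  let ?E = "exponents d A" and ?\<psi> = "taylor_fps c"
  note hom = is_ring_homD[OF is_ring_hom_taylor_fps] is_ring_hom_sum[OF is_ring_hom_taylor_fps]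
    is_ring_hom_prod[OF is_ring_hom_taylor_fps]
  have hom_power: "?\<psi> (p ^ m) = ?\<psi> p ^ m" for p m by (induction m) (auto simp: hom)
  have hom_smult: "?\<psi> (smult r p) = fps_const r * ?\<psi> p" for r p
    by (simp add: taylor_fps_def pcompose_smult fps_of_poly_smult)
  define L where "L a = ?\<psi> [:a, 1:]" for a
  have "\<exists>Y. \<forall>a\<in>A. Y a ^ d = L a"
  proof (rule bchoice, rule ballI)
    fix a assume "a \<in> A"
    then show "\<exists>Z. Z ^ d = L a" unfolding L_def
      by (intro fps_nth_root_exists of_nat_d) (use c in \<open>auto simp: taylor_fps_linear\<close>)
  qed
  then obtain Y where Y: "\<And>a. a \<in> A \<Longrightarrow> Y a ^ d = L a" by blast
  define \<mu> where "\<mu> a = fps_nth (L a ^ N * Y a) 0" for a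
  have \<mu>: "fps_X ^ q dvd L a ^ N * Y a - fps_const (\<mu> a)" "\<mu> a \<noteq> 0" if "a \<in> A" for a
  proof -
    have "(L a ^ N * Y a) ^ d = L a ^ q"
      using Y[OF that] by (simp add: q power_mult_distrib flip: power_mult) (simp add: mult.commute)
    also have "\<dots> = ?\<psi> ([:a, 1:] ^ q)" by (simp add: L_def hom_power)
    also have "\<dots> = ?\<psi> ([:-c, 1:] ^ q + [:a + c:])"
    proof -
      have "[:-c:] + [:a + c:] = [:a:]" by simp
      moreover have "a \<in> K" "-c \<in> K" using A that uminus_mem_K[OF c(1)] by auto
      ultimately show ?thesis by (simp only: frobenius_linear_poly add.assoc)
    qed
    also have "\<dots> = fps_X ^ q + fps_const (a + c)"
    proof -
      have "?\<psi> [:-c, 1:] = fps_X" by (simp add: taylor_fps_linear)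
      moreover have "?\<psi> [:a + c:] = fps_const (a + c)" by (simp add: taylor_fps_def)
      ultimately show ?thesis by (simp only: hom hom_power)
    qed
    finally have W: "(L a ^ N * Y a) ^ d = fps_X ^ q + fps_const (a + c)" .
    have ac: "a + c \<noteq> 0" "q > 0" using c(2)[OF that] q by (auto simp: add.commute)
    show "fps_X ^ q dvd L a ^ N * Y a - fps_const (\<mu> a)" "\<mu> a \<noteq> 0"
      using fps_X_power_dvd_diff_const[OF of_nat_d ac(2,1) W] by (simp_all add: \<mu>_def)
  qed
  \<comment> \<open>\<open>(x + a) ^ (N * e a)\<close> acts like \<open>Y a\<close> to the power
    \<open>- e a\<close>; multiplication by all \<open>Y a ^ (d - 1)\<close> makes the exponents
    \<open>d - 1 - e a\<close>, again below \<open>d\<close>.\<close>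
  define rev where "rev e = (\<lambda>a\<in>A. d - 1 - e a)" for e :: "'k \<Rightarrow> nat"
  have rev: "rev e \<in> ?E" for e using d by (auto simp: rev_def exponents_def)
  have rev_rev: "rev (rev e) = e" if "e \<in> ?E" for e
    using that by (auto simp: rev_def exponents_def PiE_def extensional_def fun_eq_iff Pi_def)
  define P' where "P' f = smult (\<Prod>a\<in>A. \<mu> a ^ rev f a) (P (rev f))" for f
  have "(\<Sum>e\<in>?E. ?\<psi> (P e) * (\<Prod>a\<in>A. fps_const (\<mu> a) ^ e a * Y a ^ rev e a)) =
      (\<Sum>f\<in>?E. ?\<psi> (P (rev f)) * (\<Prod>a\<in>A. fps_const (\<mu> a) ^ rev f a * Y a ^ f a))"
    by (rule sum.reindex_bij_witness[of _ rev rev]) (use rev rev_rev in auto)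
  also have "\<dots> = (\<Sum>f\<in>?E. ?\<psi> (P' f) * power_prod A Y f)"
  proof (rule sum.cong[OF refl])
    fix f
    have "fps_const (\<Prod>a\<in>A. \<mu> a ^ rev f a) = (\<Prod>a\<in>A. fps_const (\<mu> a) ^ rev f a)"
      by (induction A rule: infinite_finite_induct) (auto simp flip: fps_const_mult)
    then show "?\<psi> (P (rev f)) * (\<Prod>a\<in>A. fps_const (\<mu> a) ^ rev f a * Y a ^ f a) = ?\<psi> (P' f) * power_prod A Y f"
      by (simp add: P'_def hom_smult power_prod_def prod.distrib)
  qed
  finally have sum_eq: "(\<Sum>e\<in>?E. ?\<psi> (P e) * (\<Prod>a\<in>A. fps_const (\<mu> a) ^ e a * Y a ^ rev e a)) =
    (\<Sum>f\<in>?E. ?\<psi> (P' f) * power_prod A Y f)" .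
  define S where "S = (\<Sum>e\<in>?E. ?\<psi> (P e) * (\<Prod>a\<in>A. L a ^ (N * e a)))"
  have "S = ?\<psi> (\<Sum>e\<in>?E. P e * (\<Prod>a\<in>A. [:a, 1:] ^ (N * e a)))"
    by (simp add: S_def L_def hom hom_power)
  moreover obtain k where "(\<Sum>e\<in>?E. P e * (\<Prod>a\<in>A. [:a, 1:] ^ (N * e a))) = [:-c, 1:] ^ q * k"
    using dvd by (elim dvdE)
  moreover have "?\<psi> [:-c, 1:] = fps_X" by (simp add: taylor_fps_linear)
  ultimately have "S = fps_X ^ q * ?\<psi> k" by (simp only: hom hom_power)
  then have S_dvd: "fps_X ^ q dvd S" by simp
  have S_cong: "fps_X ^ q dvd S * (\<Prod>a\<in>A. Y a ^ (d - 1)) -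
      (\<Sum>e\<in>?E. ?\<psi> (P e) * (\<Prod>a\<in>A. fps_const (\<mu> a) ^ e a * Y a ^ rev e a))"
  proof -
    have "fps_X ^ q dvd ?\<psi> (P e) * (\<Prod>a\<in>A. L a ^ (N * e a) * Y a ^ (d - 1)) -
        ?\<psi> (P e) * (\<Prod>a\<in>A. fps_const (\<mu> a) ^ e a * Y a ^ rev e a)" if e: "e \<in> ?E" for e
    proof -
      have "fps_X ^ q dvd L a ^ (N * e a) * Y a ^ (d - 1) - fps_const (\<mu> a) ^ e a * Y a ^ rev e a"
        if a: "a \<in> A" for a
      proof -
        have "e a < d" using e a by (auto simp: exponents_def)
        then have "d - 1 = e a + rev e a" using a by (simp add: rev_def)
        then have "L a ^ (N * e a) * Y a ^ (d - 1) = (L a ^ N * Y a) ^ e a * Y a ^ rev e a"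
          by (simp only: power_add power_mult power_mult_distrib mult.assoc)
        then show ?thesis using dvd_diff_mult[OF dvd_diff_power[OF \<mu>(1)[OF a]], of "Y a ^ rev e a" "Y a ^ rev e a"]
          by simp
      qed
      then show ?thesis by (rule dvd_diff_mult[OF _ dvd_diff_prod, rotated]) simp_all
    qed
    then have "fps_X ^ q dvd (\<Sum>e\<in>?E. ?\<psi> (P e) * (\<Prod>a\<in>A. L a ^ (N * e a) * Y a ^ (d - 1)) -
        ?\<psi> (P e) * (\<Prod>a\<in>A. fps_const (\<mu> a) ^ e a * Y a ^ rev e a))" by (rule dvd_sum)
    then show ?thesis
      by (simp add: S_def sum_subtractf sum_distrib_right prod.distrib mult.assoc)
  qed
  have X_dvd: "fps_X ^ q dvd (\<Sum>f\<in>?E. ?\<psi> (P' f) * power_prod A Y f)"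
    using dvd_diff[OF dvd_mult2[OF S_dvd, of "\<Prod>a\<in>A. Y a ^ (d - 1)"] S_cong] unfolding sum_eq by (simp only: diff_diff_eq2 add_diff_cancel_left')
  have degP': "degree (P' e) < D" for e using D[OF rev, of e] by (simp add: P'_def le_less_trans[OF degree_smult_le])
  have "\<exists>W R. (\<exists>e\<in>?E. W e \<noteq> 0) \<and> degree R \<le> d ^ card A * (D + card A) \<and>
    (\<forall>(\<psi> :: 'k poly \<Rightarrow> 'k fps) Y. is_ring_hom \<psi> \<longrightarrow> (\<forall>a\<in>A. Y a ^ d = \<psi> [:a, 1:]) \<longrightarrow>
       (\<Sum>e\<in>?E. \<psi> (P' e) * power_prod A Y e) * (\<Sum>e\<in>?E. \<psi> (W e) * power_prod A Y e) = \<psi> R)"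
    using d by (intro bounded_degree_multiple degP' A) auto
  then obtain W R where W: "\<exists>e\<in>?E. W e \<noteq> 0" and degR: "degree R \<le> d ^ card A * (D + card A)" and R:
    "(\<Sum>e\<in>?E. ?\<psi> (P' e) * power_prod A Y e) * (\<Sum>e\<in>?E. ?\<psi> (W e) * power_prod A Y e) = ?\<psi> R"
    using is_ring_hom_taylor_fps[of c] Y unfolding L_def by blast
  have indep: "\<forall>e\<in>?E. U e = 0" if "(\<Sum>e\<in>?E. ?\<psi> (U e) * power_prod A Y e) = 0" for U
    by (rule kummer_independent[OF A(1) of_nat_d c(2) _ that]) (use Y in \<open>auto simp: L_def\<close>)
  have "fps_X ^ q dvd ?\<psi> R" using X_dvd by (auto simp flip: R)
  have "(\<Sum>e\<in>?E. ?\<psi> (P' e) * power_prod A Y e) * (\<Sum>e\<in>?E. ?\<psi> (W e) * power_prod A Y e) = 0"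
    unfolding R
  proof (rule fps_ext)
    fix i
    show "fps_nth (?\<psi> R) i = fps_nth 0 i"
    proof (cases "i < q")
      case True
      then show ?thesis using fps_X_power_dvd_imp_nth_eq_0[OF \<open>fps_X ^ q dvd ?\<psi> R\<close>] by simp
    next
      case False
      have "degree (pcompose R [:c, 1:]) = degree R" by (simp add: degree_pcompose)
      then have "degree (pcompose R [:c, 1:]) < i" using degR small False by linarith
      then show ?thesis by (simp add: taylor_fps_def coeff_eq_0)
    qed
  qed
  moreover have "(\<Sum>e\<in>?E. ?\<psi> (W e) * power_prod A Y e) \<noteq> 0" using indep W by blast
  ultimately have "(\<Sum>e\<in>?E. ?\<psi> (P' e) * power_prod A Y e) = 0" by (simp only: mult_eq_0_iff simp_thms)
  then have P'0: "\<forall>e\<in>?E. P' e = 0" by (rule indep)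
  show ?thesis
  proof
    fix e assume "e \<in> ?E"
    then have "P' (rev e) = smult (\<Prod>a\<in>A. \<mu> a ^ e a) (P e)" by (simp add: P'_def rev_rev)
    moreover have "(\<Prod>a\<in>A. \<mu> a ^ e a) \<noteq> 0" using \<mu>(2) A(1) by auto
    ultimately show "P e = 0" using P'0 rev[of e] by auto
  qed
qed

text \<open>
  The exponent vector \<open>d\<close> at a single \<open>b\<close> is also admissible, because \<open>(x + b) (x + b)^(N d) = x^q + b\<close>
  is constant modulo \<open>(x - c)^q\<close>, with different constants for different \<open>c\<close>.
\<close>
lemma nonvanishing:
  assumes A: "finite A" "A \<subseteq> K" and b: "b \<in> A"
    and F: "F \<subseteq> insert ((\<lambda>a\<in>A. 0)(b := d)) (exponents d A)"
    and D: "\<And>e. e \<in> F \<Longrightarrow> degree (P e) < D"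
    and small: "d ^ card A * (D + 1 + card A) < q" and card: "card A + 2 \<le> q"
    and zero: "(\<Sum>e\<in>F. P e * (\<Prod>a\<in>A. [:a, 1:] ^ (N * e a))) = 0"
  shows "\<forall>e\<in>F. P e = 0"
proof (cases "F = {}")
  case False
  let ?E = "exponents d A"
  define s where "s = (\<lambda>a\<in>A. 0)(b := d)"
  define z where "z = (\<lambda>a\<in>A. 0::nat)"
  define P' where "P' e = (if e \<in> F then P e else 0)" for e
  have D0: "D > 0" using D False by fastforce
  have s: "s \<notin> ?E" using b by (auto simp: s_def exponents_def PiE_def Pi_def)
  have z: "z \<in> ?E" using d by (auto simp: z_def exponents_def)
  have finK: "finite K" using card_K q by (metis card.infinite nat.distinct(1) add_is_0 zero_neq_one)
  define C where "C = K - uminus ` A"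
  have "card K \<le> card (K - uminus ` A) + card (uminus ` A)"
    by (metis A(1) finite_imageI add.commute card_Un_le finK Un_Diff_cancel le_trans card_mono finite_UnI finite_Diff sup_ge1 sup_commute)
  moreover have "card (uminus ` A) \<le> card A" by (rule card_image_le[OF A(1)])
  ultimately have "card C \<ge> 2" using card card_K by (simp add: C_def)
  \<comment> \<open>Each admissible point yields one relation; only the difference of two of them
    isolates the coefficient \<open>P' s\<close>.\<close>
  then obtain c1 c2 where c: "c1 \<in> C" "c2 \<in> C" "c1 \<noteq> c2" by (metis card_2_iff' card_le_Suc_iff obtain_subset_with_card_n subsetD)
  let ?u = "\<lambda>e. \<Prod>a\<in>A. [:a, 1:] ^ (N * e a)"
  have "0 = (\<Sum>e\<in>insert s ?E. P' e * ?u e)"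
  proof -
    have "(\<Sum>e\<in>insert s ?E. P' e * ?u e) = (\<Sum>e\<in>F. P e * ?u e)"
      using F A(1) by (intro sum.mono_neutral_cong_right) (auto simp: P'_def s_def)
    then show ?thesis using zero by simp
  qed
  also have "\<dots> = P' s * ?u s + (\<Sum>e\<in>?E. P' e * ?u e)" using s A(1) by simp
  also have "?u s = [:b, 1:] ^ (N * d)"
    using A(1) b by (subst prod.remove[OF _ b]) (auto simp: s_def intro!: prod.neutral)
  \<comment> \<open>The factor \<open>x + b\<close> completes \<open>N * d\<close> to the exponent
    \<open>q\<close>. It raises degrees by one, hence \<open>D + 1\<close> in
    \<open>small\<close>.\<close>
  finally have "0 = [:b, 1:] * (P' s * [:b, 1:] ^ (N * d) + (\<Sum>e\<in>?E. P' e * ?u e))" by simp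
  also have "\<dots> = P' s * [:b, 1:] ^ q + (\<Sum>e\<in>?E. [:b, 1:] * P' e * ?u e)"
    by (simp only: q power_add power_one_right distrib_left sum_distrib_left mult_ac)
  finally have eq: "P' s * [:b, 1:] ^ q + (\<Sum>e\<in>?E. [:b, 1:] * P' e * ?u e) = 0" by simp
  have key: "\<forall>e\<in>?E. [:b, 1:] * P' e + (if e = z then smult (b + c) (P' s) else 0) = 0" if "c \<in> C" for c
  proof (rule nonvanishing_at_point[OF A])
    show "c \<in> K" "\<And>a. a \<in> A \<Longrightarrow> c + a \<noteq> 0"
      using that by (auto simp: C_def eq_neg_iff_add_eq_0 image_iff)
    fix e
    have "degree (P' e) < D" "degree (P' s) < D" using D D0 by (auto simp: P'_def)
    moreover have "degree ([:b, 1:] * P' e) \<le> degree [:b, 1:] + degree (P' e)" by (rule degree_mult_le)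
    ultimately have "degree ([:b, 1:] * P' e) < D + 1"
      "degree (if e = z then smult (b + c) (P' s) else 0) < D + 1"
      using degree_smult_le[of "b + c" "P' s"] by (simp_all del: mult_pCons_left)
    then show "degree ([:b, 1:] * P' e + (if e = z then smult (b + c) (P' s) else 0)) < D + 1"
      by (rule degree_add_less)
  next
    have cK: "- c \<in> K" using that uminus_mem_K by (auto simp: C_def)
    have "[:-c:] + [:b + c:] = [:b:]" by simp
    moreover have "b \<in> K" using A b by auto
    ultimately have "[:b, 1:] ^ q = [:-c, 1:] ^ q + [:b + c:]"
      using cK by (simp only: frobenius_linear_poly add.assoc)
    moreover have "P' s * [:b + c:] = smult (b + c) (P' s)" by simp
    ultimately have "P' s * [:b, 1:] ^ q = [:-c, 1:] ^ q * P' s + smult (b + c) (P' s)"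
      by (simp only: distrib_left mult.commute[of "P' s" "[:-c, 1:] ^ q"])
    moreover have "t + r = - u" if "x = u + r" "x + t = 0" for r t u x :: "'k poly"
      using that by (simp add: eq_neg_iff_add_eq_0 algebra_simps)
    ultimately have "(\<Sum>e\<in>?E. [:b, 1:] * P' e * ?u e) + smult (b + c) (P' s) = [:-c, 1:] ^ q * - P' s"
      using eq unfolding mult_minus_right by blast
    moreover have "(\<Sum>e\<in>?E. (if e = z then smult (b + c) (P' s) else 0) * ?u e) = smult (b + c) (P' s)"
    proof -
      have "?u z = 1" by (simp add: z_def)
      then show ?thesis using z A(1) by (simp add: if_distrib[of "\<lambda>x. x * _"] cong: if_cong)
    qed
    ultimately have "(\<Sum>e\<in>?E. ([:b, 1:] * P' e + (if e = z then smult (b + c) (P' s) else 0)) * ?u e) =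
        [:-c, 1:] ^ q * - P' s"
      by (simp add: distrib_right sum.distrib)
    then show "[:-c, 1:] ^ q dvd (\<Sum>e\<in>?E. ([:b, 1:] * P' e + (if e = z then smult (b + c) (P' s) else 0)) * ?u e)"
      by simp
  qed (use small in simp)
  have "[:b, 1:] * P' z + smult (b + c) (P' s) = 0" if "c \<in> C" for c
    using bspec[OF key[OF that] z] by (simp only: refl if_True)
  then have "smult (b + c1) (P' s) = smult (b + c2) (P' s)" using c by (metis add_left_cancel)
  then have "smult ((b + c1) - (b + c2)) (P' s) = 0" by (simp only: smult_diff_left diff_self)
  then have s0: "P' s = 0" using c(3) by simp
  have "P' e = 0" if "e \<in> ?E" for e
  proof -
    have "[:b, 1:] * P' e = 0"
      using bspec[OF key[OF c(1)] that] s0 by (simp only: smult_0_right if_cancel add_0_right)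
    then show ?thesis by (simp only: mult_eq_0_iff pCons_eq_0_iff one_neq_zero simp_thms)
  qed
  then have "P' e = 0" if "e \<in> F" for e using that s0 F unfolding s_def by blast
  then show ?thesis by (simp add: P'_def)
qed auto

end

section \<open>Stepanov's method\<close>

text \<open>A weighted degree in two variables: \<open>k\<close> is the degree in the inner variable
  that each power of the outer one may bring along, \<open>m\<close> the remaining excess, which is
  additive under products.\<close>

definition bipoly_bound :: "nat \<Rightarrow> nat \<Rightarrow> 'k::comm_ring_1 poly poly \<Rightarrow> bool" where
  "bipoly_bound k m W \<longleftrightarrow> (\<forall>l. degree (coeff W l) \<le> m + k * l)"

lemma bipoly_bound_mult:
  assumes "bipoly_bound k m V" "bipoly_bound k m' W"
  shows "bipoly_bound k (m + m') (V * W)"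
  unfolding bipoly_bound_def
proof
  fix l
  show "degree (coeff (V * W) l) \<le> m + m' + k * l"
    unfolding coeff_mult
  proof (rule degree_sum_le)
    fix i assume i: "i \<in> {..l}"
    have "degree (coeff V i * coeff W (l - i)) \<le> (m + k * i) + (m' + k * (l - i))"
      using assms by (intro order.trans[OF degree_mult_le] add_mono) (auto simp: bipoly_bound_def)
    also have "\<dots> = m + m' + k * (i + (l - i))" by (simp add: distrib_left)
    also have "\<dots> = m + m' + k * l" using i by simp
    finally show "degree (coeff V i * coeff W (l - i)) \<le> m + m' + k * l" .
  qed simp
qed

lemma bipoly_bound_one: "bipoly_bound k 0 1"
  by (auto simp: bipoly_bound_def coeff_1)

lemma bipoly_bound_power: "bipoly_bound k m V \<Longrightarrow> bipoly_bound k (m * i) (V ^ i)"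
  by (induction i) (auto simp: bipoly_bound_one dest: bipoly_bound_mult)

lemma bipoly_bound_prod:
  "(\<And>a. a \<in> A \<Longrightarrow> bipoly_bound k 0 (V a)) \<Longrightarrow> bipoly_bound k 0 (\<Prod>a\<in>A. V a)"
proof (induction A rule: infinite_finite_induct)
  case (insert a A)
  then show ?case using bipoly_bound_mult[of k 0 "V a" 0 "prod V A"] by simp
qed (auto simp: bipoly_bound_one)

lemma bipoly_bound_pcompose:
  fixes p :: "'k::comm_ring_1 poly"
  assumes "bipoly_bound k 1 V"
  shows "bipoly_bound k (degree p) (pcompose (map_poly (\<lambda>c. [:c:]) p) V)"
proof (induction p)
  case 0
  then show ?case by (simp add: bipoly_bound_def)
next
  case (pCons c p)
  show ?case
  proof (cases "p = 0")
    case True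
    then show ?thesis by (auto simp: bipoly_bound_def map_poly_pCons coeff_pCons split: nat.splits)
  next
    case False
    have "bipoly_bound k (1 + degree p) (V * pcompose (map_poly (\<lambda>c. [:c:]) p) V)"
      by (rule bipoly_bound_mult[OF assms pCons.IH])
    then have "bipoly_bound k (1 + degree p) ([:[:c:]:] + V * pcompose (map_poly (\<lambda>c. [:c:]) p) V)"
      unfolding bipoly_bound_def coeff_add
      by (intro allI degree_add_le) (auto simp: coeff_pCons split: nat.splits)
    then show ?thesis using False by (simp add: map_poly_pCons pcompose_pCons)
  qed
qed

lemma map_poly_eval_add:
  "map_poly (\<lambda>p. poly p (x::'k::comm_ring_1)) (V + W) = map_poly (\<lambda>p. poly p x) V + map_poly (\<lambda>p. poly p x) W"
  by (rule poly_eqI) (simp add: coeff_map_poly)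

lemma map_poly_eval_mult:
  "map_poly (\<lambda>p. poly p (x::'k::comm_ring_1)) (V * W) = map_poly (\<lambda>p. poly p x) V * map_poly (\<lambda>p. poly p x) W"
  by (rule poly_eqI) (simp add: coeff_map_poly coeff_mult poly_sum)

lemma is_ring_hom_map_poly_eval: "is_ring_hom (map_poly (\<lambda>p. poly p (x::'k::comm_ring_1)))"
  by (simp add: is_ring_hom_def map_poly_eval_add map_poly_eval_mult map_poly_1)

lemma map_poly_eval_pcompose:
  "map_poly (\<lambda>p. poly p (x::'k::comm_ring_1)) (pcompose (map_poly (\<lambda>c. [:c:]) p) V) =
     pcompose p (map_poly (\<lambda>p. poly p x) V)"
  by (induction p) (auto simp: map_poly_pCons pcompose_pCons map_poly_eval_add map_poly_eval_mult)

lemma pcompose_power: "pcompose (p ^ n) r = pcompose p r ^ n" for p :: "'k::comm_ring_1 poly"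
  by (induction n) (auto simp: pcompose_mult pcompose_1)

text \<open>In positive characteristic high derivatives vanish identically, so the multiplicity of a
  zero is read off from the expansion around it; scaling the increment by a nonzero \<open>h\<close>
  does not change it.\<close>

lemma power_dvd_if_coeff_pcompose_eq_0:
  fixes p :: "'k::field poly"
  assumes "h \<noteq> 0" "\<And>l. l < M \<Longrightarrow> coeff (pcompose p [:x, h:]) l = 0"
  shows "[:-x, 1:] ^ M dvd p"
proof -
  have "monom 1 M dvd pcompose p [:x, h:]"
    using assms(2) by (simp add: monom_1_dvd_iff')
  then obtain r where r: "pcompose p [:x, h:] = monom 1 M * r" by (elim dvdE)
  have "[:x, h:] \<circ>\<^sub>p [:- x / h, 1 / h:] = [:0, 1:]"
    using assms(1) by (simp add: pcompose_pCons)
  then have "p = pcompose (pcompose p [:x, h:]) [:- x / h, 1 / h:]"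
    by (simp flip: pcompose_assoc)
  also have "\<dots> = [:- x / h, 1 / h:] ^ M * pcompose r [:- x / h, 1 / h:]"
    unfolding r by (simp add: pcompose_mult monom_altdef pcompose_power pcompose_pCons)
  also have "[:- x / h, 1 / h:] = smult (1 / h) [:-x, 1:]" by simp
  finally have "p = [:-x, 1:] ^ M * smult ((1 / h) ^ M) (pcompose r (smult (1 / h) [:-x, 1:]))"
    by (simp only: smult_power mult_smult_left mult_smult_right)
  then show ?thesis by (rule dvdI)
qed

lemma card_mult_le_degree:
  fixes p :: "'k::field poly"
  assumes "p \<noteq> 0" "\<And>x. x \<in> B \<Longrightarrow> [:-x, 1:] ^ M dvd p"
  shows "M * card B \<le> degree p"
proof (cases "M = 0")
  case False
  have B: "B \<subseteq> {x. poly p x = 0}"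
  proof
    fix x assume "x \<in> B"
    then have "[:-x, 1:] dvd p" using assms(2)[of x] False dvd_power[of M "[:-x, 1:]"] dvd_trans by blast
    then show "x \<in> {x. poly p x = 0}" by (simp add: poly_eq_0_iff_dvd)
  qed
  have "M * card B = (\<Sum>x\<in>B. M)" by simp
  also have "\<dots> \<le> (\<Sum>x\<in>B. order x p)"
    using assms by (intro sum_mono) (auto simp: order_divides)
  also have "\<dots> \<le> (\<Sum>x | poly p x = 0. order x p)"
    using B assms(1) by (intro sum_mono2) (auto simp: poly_roots_finite)
  also have "\<dots> = size (proots p)"
    using assms(1) by (simp add: size_multiset_overloaded_eq)
  also have "\<dots> \<le> degree p" by (rule size_proots_le)
  finally show ?thesis .
qed simp

context power_residues
begin

text \<open>
  Stepanov's method: a combination \<open>G\<close> of the polynomials \<open>(\<Prod>a. (x + a)^e a)^N\<close> with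
  coefficients of low degree vanishes to order \<open>M\<close> on \<open>B\<close>. The expansion of \<open>G\<close> around \<open>x\<close> in
  the variable \<open>t h(x)\<close>, \<open>h = (\<Prod>a. x + a)\<close>, keeps the conditions polynomial in \<open>x\<close> once
  the powers \<open>(x + a)^N\<close> are replaced by their values on \<open>B\<close>.
\<close>
lemma stepanov_bound:
  fixes A :: "'k set"
  assumes A: "finite A" and F: "finite F"
    and B: "\<And>x a. x \<in> B \<Longrightarrow> a \<in> A \<Longrightarrow> (x + a) ^ N = \<omega> a" and \<omega>: "\<And>a. a \<in> A \<Longrightarrow> \<omega> a \<noteq> 0"
    and s: "\<And>e. e \<in> F \<Longrightarrow> (\<Sum>a\<in>A. e a) \<le> s"
    and count: "(\<Sum>l<M. D + card A * l) < card F * D"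
    and indep: "\<And>P. (\<And>e. e \<in> F \<Longrightarrow> degree (P e) < D) \<Longrightarrow>
      (\<Sum>e\<in>F. P e * (\<Prod>a\<in>A. [:a, 1:] ^ (N * e a))) = 0 \<Longrightarrow> \<forall>e\<in>F. P e = 0"
  shows "M * card B \<le> D + N * s"
proof -
  define h where "h = (\<Prod>a\<in>A. [:a, 1:])"
  define ha where "ha a = (\<Prod>b\<in>A - {a}. [:b, 1:])" for a :: 'k
  have deg_prod: "degree (\<Prod>b\<in>C. [:b, 1:]) \<le> card C" if "finite C" for C :: "'k set"
    using degree_prod_sum_le[OF that, of "\<lambda>b. [:b, 1:]"] by simp
  \<comment> \<open>\<open>V p\<close> is \<open>p(x + h t)\<close>. As
    \<open>h = (x + a) * ha a\<close>, the same shift multiplies \<open>x + a\<close> by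
    \<open>1 + ha a * t\<close>, whose powers form \<open>W e\<close>. The remaining factor
    \<open>(x + a) ^ (N * e a)\<close> is replaced in \<open>T\<close> by
    \<open>\<omega> a ^ e a\<close>, so the degree of \<open>T\<close> in \<open>x\<close> does not
    depend on \<open>N\<close>.\<close>
  define V where "V p = pcompose (map_poly (\<lambda>c. [:c:]) p) [:[:0, 1:], h:]" for p :: "'k poly"
  define W where "W e = (\<Prod>a\<in>A. [:1, ha a:] ^ (N * e a))" for e :: "'k \<Rightarrow> nat"
  define T where "T l e p = smult (\<Prod>a\<in>A. \<omega> a ^ e a) (coeff (V p * W e) l)" for l e p
  have bV: "bipoly_bound (card A) (degree p) (V p)" for p
    unfolding V_def
    by (rule bipoly_bound_pcompose)
       (use deg_prod[OF A] in \<open>auto simp: bipoly_bound_def coeff_pCons h_def split: nat.splits\<close>)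
  have bW: "bipoly_bound (card A) 0 (W e)" for e
  proof -
    have "bipoly_bound (card A) 0 [:1, ha a:]" for a
    proof -
      have "degree (ha a) \<le> card A"
        unfolding ha_def using A deg_prod[of "A - {a}"] card_Diff1_le[of A a] by (meson finite_Diff le_trans)
      then show ?thesis by (auto simp: bipoly_bound_def coeff_pCons split: nat.splits)
    qed
    then show ?thesis unfolding W_def
      using bipoly_bound_power[of "card A" 0] by (intro bipoly_bound_prod) fastforce
  qed
  have degT: "degree (T l e p) < D + card A * l" if "degree p < D" for l e p
  proof -
    have "degree (T l e p) \<le> degree (coeff (V p * W e) l)" by (simp add: T_def degree_smult_le)
    also have "\<dots> \<le> degree p + card A * l"
      using bipoly_bound_mult[OF bV bW] by (simp add: bipoly_bound_def)
    finally show ?thesis using that by simp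
  qed
  have V_add: "V (p + r) = V p + V r" for p r
  proof -
    have "map_poly (\<lambda>c. [:c:]) (p + r) = map_poly (\<lambda>c. [:c:]) p + map_poly (\<lambda>c. [:c:]) r"
      by (rule poly_eqI) (simp add: coeff_map_poly)
    then show ?thesis by (simp add: V_def pcompose_add)
  qed
  have V_smult: "V (smult c p) = smult [:c:] (V p)" for c p
  proof -
    have "map_poly (\<lambda>c. [:c:]) (smult c p) = smult [:c:] (map_poly (\<lambda>c. [:c:]) p)"
      by (rule poly_eqI) (simp add: coeff_map_poly)
    then show ?thesis by (simp add: V_def pcompose_smult)
  qed
  have T_add: "T l e (p + r) = T l e p + T l e r" for l e p r
    by (simp add: T_def V_add distrib_right smult_add_right)
  have T_smult: "T l e (smult c p) = smult c (T l e p)" for l e c p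
    by (simp add: T_def V_smult mult.commute)
  have "\<exists>P. (\<exists>e\<in>F. P e \<noteq> 0) \<and> (\<forall>e\<in>F. degree (P e) < D) \<and> (\<forall>l\<in>{..<M}. (\<Sum>e\<in>F. T l e (P e)) = 0)"
    by (rule linear_polynomial_system_nontrivial_solution[OF F _ _ _ _ count])
       (use degT T_add T_smult in auto)
  then obtain P where P: "\<exists>e\<in>F. P e \<noteq> 0" "\<And>e. e \<in> F \<Longrightarrow> degree (P e) < D"
    "\<And>l. l < M \<Longrightarrow> (\<Sum>e\<in>F. T l e (P e)) = 0" by auto
  define G where "G = (\<Sum>e\<in>F. P e * (\<Prod>a\<in>A. [:a, 1:] ^ (N * e a)))"
  have "G \<noteq> 0" using indep[of P] P unfolding G_def by blast
  have "[:-x, 1:] ^ M dvd G" if x: "x \<in> B" for x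
  proof (rule power_dvd_if_coeff_pcompose_eq_0)
    have xa: "x + a \<noteq> 0" if "a \<in> A" for a
      using B[OF x that] \<omega>[OF that] N by (auto simp: zero_power)
    then show "poly h x \<noteq> 0" using A by (auto simp: h_def poly_prod add.commute)
    fix l assume l: "l < M"
    let ?ev = "map_poly (\<lambda>p. poly p x)"
    note hom = is_ring_homD[OF is_ring_hom_map_poly_eval] is_ring_hom_prod[OF is_ring_hom_map_poly_eval]
    have hom_power: "?ev (p ^ m) = ?ev p ^ m" for p m by (induction m) (simp_all only: power_0 power_Suc hom)
    have pow: "pcompose [:a, 1:] [:x, poly h x:] = smult (x + a) (?ev [:1, ha a:])" if a: "a \<in> A" for a
    proof -
      have "h = [:a, 1:] * ha a" unfolding h_def ha_def by (rule prod.remove[OF A a])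
      then have "poly h x = (x + a) * poly (ha a) x" by (simp add: algebra_simps)
      then show ?thesis by (simp add: pcompose_pCons map_poly_pCons)
    qed
    have "pcompose (\<Prod>a\<in>A. [:a, 1:] ^ (N * e a)) [:x, poly h x:] = smult (\<Prod>a\<in>A. \<omega> a ^ e a) (?ev (W e))" for e
    proof -
      have "pcompose (\<Prod>a\<in>A. [:a, 1:] ^ (N * e a)) [:x, poly h x:] =
          (\<Prod>a\<in>A. smult (\<omega> a ^ e a) (?ev ([:1, ha a:] ^ (N * e a))))"
        unfolding pcompose_prod
      proof (rule prod.cong[OF refl])
        fix a assume a: "a \<in> A"
        have "(x + a) ^ (N * e a) = \<omega> a ^ e a" using B[OF x a] by (simp add: power_mult)
        then show "pcompose ([:a, 1:] ^ (N * e a)) [:x, poly h x:] = smult (\<omega> a ^ e a) (?ev ([:1, ha a:] ^ (N * e a)))"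
          by (simp only: pcompose_power pow[OF a] smult_power hom_power)
      qed
      then show ?thesis by (simp add: W_def prod_smult hom)
    qed
    moreover have "pcompose (P e) [:x, poly h x:] = ?ev (V (P e))" for e
      by (simp add: V_def map_poly_eval_pcompose map_poly_pCons)
    ultimately have "pcompose G [:x, poly h x:] = (\<Sum>e\<in>F. smult (\<Prod>a\<in>A. \<omega> a ^ e a) (?ev (V (P e) * W e)))"
      by (simp add: G_def pcompose_sum pcompose_mult hom)
    then have "coeff (pcompose G [:x, poly h x:]) l = (\<Sum>e\<in>F. poly (T l e (P e)) x)"
      by (simp add: coeff_sum coeff_map_poly T_def)
    also have "\<dots> = poly (\<Sum>e\<in>F. T l e (P e)) x" by (simp add: poly_sum)
    finally show "coeff (pcompose G [:x, poly h x:]) l = 0" using P(3)[OF l] by simp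
  qed
  then have "M * card B \<le> degree G" by (rule card_mult_le_degree[OF \<open>G \<noteq> 0\<close>])
  also have "\<dots> \<le> D + N * s"
    unfolding G_def
  proof (rule degree_sum_le[OF F])
    fix e assume e: "e \<in> F"
    have "degree (\<Prod>a\<in>A. [:a, 1:] ^ (N * e a)) \<le> (\<Sum>a\<in>A. degree ([:a, 1:] ^ (N * e a)))"
      using degree_prod_sum_le[OF A] by auto
    also have "\<dots> \<le> (\<Sum>a\<in>A. N * e a)"
      by (intro sum_mono order.trans[OF degree_power_le]) simp
    also have "\<dots> \<le> N * s" using s[OF e] by (simp flip: sum_distrib_left)
    finally show "degree (P e * (\<Prod>a\<in>A. [:a, 1:] ^ (N * e a))) \<le> D + N * s"
      using P(2)[OF e] by (intro order.trans[OF degree_mult_le] add_mono) auto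
  qed
  finally show ?thesis .
qed

end

section \<open>Sumsets and intersections of translates\<close>

lemma square_sum_le:
  fixes f :: "'a \<Rightarrow> nat"
  shows "(\<Sum>i\<in>I. f i)\<^sup>2 \<le> card I * (\<Sum>i\<in>I. (f i)\<^sup>2)"
proof -
  have le: "2 * (x * y) \<le> x\<^sup>2 + y\<^sup>2" for x y :: nat
  proof -
    have "2 * (int x * int y) \<le> (int x)\<^sup>2 + (int y)\<^sup>2"
      using zero_le_power2[of "int x - int y"] by (simp add: power2_diff)
    then have "int (2 * (x * y)) \<le> int (x\<^sup>2 + y\<^sup>2)" by simp
    then show ?thesis by (simp only: of_nat_le_iff)
  qed
  have "2 * (\<Sum>i\<in>I. f i)\<^sup>2 = (\<Sum>i\<in>I. \<Sum>j\<in>I. 2 * (f i * f j))"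
    by (simp only: power2_eq_square sum_product) (simp only: sum_distrib_left)
  also have "\<dots> \<le> (\<Sum>i\<in>I. \<Sum>j\<in>I. (f i)\<^sup>2 + (f j)\<^sup>2)"
    by (intro sum_mono le)
  also have "\<dots> = 2 * (card I * (\<Sum>i\<in>I. (f i)\<^sup>2))"
    by (simp add: sum.distrib flip: sum_distrib_left)
  finally show ?thesis by simp
qed

text \<open>By Cauchy-Schwarz over the fibres of the projection to \<open>(x, y)\<close> it suffices
  to count pairs \<open>(x, y, z)\<close>, \<open>(x, y, z')\<close> in \<open>T\<close>; such a
  pair is recovered from \<open>(x, z)\<close> and \<open>(y, z')\<close>.\<close>

lemma loomis_whitney:
  fixes T :: "('a \<times> 'b \<times> 'c) set"
  assumes fin: "finite T"
  shows "(card T)\<^sup>2 \<le> card ((\<lambda>(x, y, z). (x, y)) ` T) * (card ((\<lambda>(x, y, z). (x, z)) ` T) * card ((\<lambda>(x, y, z). (y, z)) ` T))"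
proof -
  let ?\<pi> = "\<lambda>(x, y, z). (x, y)"
  let ?T12 = "?\<pi> ` T" and ?T13 = "(\<lambda>(x, y, z). (x, z)) ` T" and ?T23 = "(\<lambda>(x, y, z). (y, z)) ` T"
  define f where "f u = {t \<in> T. ?\<pi> t = u}" for u
  have "card T = (\<Sum>u\<in>?T12. card (f u))"
    unfolding f_def using sum.image_gen[OF fin, of "\<lambda>_. 1::nat" ?\<pi>] by simp
  then have "(card T)\<^sup>2 \<le> card ?T12 * (\<Sum>u\<in>?T12. (card (f u))\<^sup>2)"
    using square_sum_le by metis
  also have "(\<Sum>u\<in>?T12. (card (f u))\<^sup>2) = card (SIGMA u:?T12. f u \<times> f u)"
    using fin by (subst card_SigmaI) (auto simp: f_def power2_eq_square card_cartesian_product)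
  also have "\<dots> \<le> card (?T13 \<times> ?T23)"
  proof (rule card_inj_on_le)
    let ?g = "\<lambda>(u, (x, y, z), (x', y', z')). ((x, z), (y', z'))"
    show "inj_on ?g (SIGMA u:?T12. f u \<times> f u)" by (auto simp: inj_on_def f_def)
    show "?g ` (SIGMA u:?T12. f u \<times> f u) \<subseteq> ?T13 \<times> ?T23" by (force simp: f_def)
  qed (use fin in simp)
  finally show ?thesis by (simp add: card_cartesian_product)
qed

definition sumset :: "'g::plus set \<Rightarrow> 'g set \<Rightarrow> 'g set" where
  "sumset A B = (\<lambda>(a, b). a + b) ` (A \<times> B)"

lemma mem_sumset_iff: "s \<in> sumset A B \<longleftrightarrow> (\<exists>a\<in>A. \<exists>b\<in>B. s = a + b)"
  by (auto simp: sumset_def)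

lemma finite_sumset [simp]: "finite A \<Longrightarrow> finite B \<Longrightarrow> finite (sumset A B)"
  by (simp add: sumset_def)

lemma card_sumset_le: "finite A \<Longrightarrow> finite B \<Longrightarrow> card (sumset A B) \<le> card A * card B"
  using card_image_le[of "A \<times> B" "\<lambda>(a, b). a + b"] by (simp add: sumset_def card_cartesian_product)

lemma sumset_commute:
  fixes A B :: "'g::ab_semigroup_add set"
  shows "sumset A B = sumset B A"
proof (rule Set.set_eqI)
  fix s
  show "s \<in> sumset A B \<longleftrightarrow> s \<in> sumset B A"
    unfolding mem_sumset_iff using add.commute by blast
qed

lemma sumset_assoc:
  fixes A B C :: "'g::ab_semigroup_add set"
  shows "sumset (sumset A B) C = sumset A (sumset B C)"
proof (rule Set.set_eqI)
  fix s
  have "s \<in> sumset (sumset A B) C \<longleftrightarrow> (\<exists>a\<in>A. \<exists>b\<in>B. \<exists>c\<in>C. s = a + b + c)"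
    by (simp only: mem_sumset_iff Bex_def) blast
  also have "\<dots> \<longleftrightarrow> (\<exists>a\<in>A. \<exists>b\<in>B. \<exists>c\<in>C. s = a + (b + c))" by (simp add: add.assoc)
  also have "\<dots> \<longleftrightarrow> s \<in> sumset A (sumset B C)"
    by (simp only: mem_sumset_iff Bex_def) blast
  finally show "s \<in> sumset (sumset A B) C \<longleftrightarrow> s \<in> sumset A (sumset B C)" .
qed

text \<open>
  Ruzsa's inequality. A sum is represented by the triple of least weight, where the weights
  are additive and separate pairs; then all three projections to pairs of summands are
  determined by their sums, and the Loomis-Whitney inequality applies.
\<close>
lemma card_sumset3_squared_le:
  fixes A B C :: "'g::ab_group_add set"
  assumes fin: "finite A" "finite B" "finite C"
  shows "(card (sumset A (sumset B C)))\<^sup>2 \<le>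
    card (sumset A B) * (card (sumset A C) * card (sumset B C))"
proof -
  have "finite (A \<union> B \<union> C)" using fin by simp
  then obtain r :: "'g \<Rightarrow> nat" where r: "inj_on r (A \<union> B \<union> C)"
    using finite_imp_inj_to_nat_seg[OF \<open>finite (A \<union> B \<union> C)\<close>] by metis
  obtain M where M: "\<And>x. x \<in> A \<union> B \<union> C \<Longrightarrow> r x < M"
    using \<open>finite (A \<union> B \<union> C)\<close> finite_nat_set_iff_bounded[of "r ` (A \<union> B \<union> C)"] by auto
  define w where "w = (\<lambda>(a, b, c). M * M * r a + M * r b + r c)"
  define R where "R s = {(a, b, c). a \<in> A \<and> b \<in> B \<and> c \<in> C \<and> a + b + c = s}" for s
  let ?S = "sumset A (sumset B C)"
  have "\<exists>t. t \<in> R s \<and> (\<forall>t'\<in>R s. w t \<le> w t')" if s: "s \<in> ?S" for s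
  proof -
    obtain a b c where "a \<in> A" "b \<in> B" "c \<in> C" "s = a + (b + c)"
      using s by (auto simp: mem_sumset_iff)
    then have "(a, b, c) \<in> R s" by (simp add: R_def add.assoc)
    then show ?thesis using ex_has_least_nat[of "\<lambda>t. t \<in> R s" "(a, b, c)" w] by blast
  qed
  then obtain g where g: "\<And>s. s \<in> ?S \<Longrightarrow> g s \<in> R s" "\<And>s t. s \<in> ?S \<Longrightarrow> t \<in> R s \<Longrightarrow> w (g s) \<le> w t"
    by metis
  define T where "T = g ` ?S"
  have finT: "finite T" using fin by (simp add: T_def)
  have "inj_on g ?S"
  proof (rule inj_onI)
    fix s s' assume "s \<in> ?S" "s' \<in> ?S" "g s = g s'"
    then have "g s \<in> R s" "g s \<in> R s'" using g(1)[of s] g(1)[of s'] by auto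
    then show "s = s'" by (auto simp: R_def)
  qed
  then have cardT: "card T = card ?S" by (simp add: T_def card_image)
  have T: "a \<in> A" "b \<in> B" "c \<in> C" if "(a, b, c) \<in> T" for a b c
  proof -
    obtain s where "s \<in> ?S" "(a, b, c) = g s" using \<open>(a, b, c) \<in> T\<close> by (auto simp: T_def)
    then have "(a, b, c) \<in> R s" using g(1)[of s] by simp
    then show "a \<in> A" "b \<in> B" "c \<in> C" by (auto simp: R_def)
  qed
  have least: "w (a, b, c) \<le> w (a', b', c')"
    if "(a, b, c) \<in> T" "a' \<in> A" "b' \<in> B" "c' \<in> C" "a + b + c = a' + b' + c'" for a b c a' b' c'
  proof -
    from that(1) obtain s where s: "s \<in> ?S" "(a, b, c) = g s" by (auto simp: T_def)
    have "a + b + c = s" using g(1)[OF s(1)] unfolding s(2)[symmetric] by (simp add: R_def)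
    then have "(a', b', c') \<in> R s" using that by (simp add: R_def)
    then show ?thesis using g(2)[OF s(1)] s(2) by simp
  qed
  have radix: "x = x' \<and> y = y'" if "M * x + y = M * x' + y'" "y < M" "y' < M" for x x' y y' :: nat
  proof -
    have "(M * x + y) div M = x" "(M * x' + y') div M = x'" using that(2,3) by simp_all
    then have "x = x'" using that(1) by simp
    then show ?thesis using that(1) by simp
  qed
  have "card ((\<lambda>(x, y, z). (x, y)) ` T) \<le> card (sumset A B)"
  proof (rule card_inj_on_le)
    show "inj_on (\<lambda>(a, b). a + b) ((\<lambda>(x, y, z). (x, y)) ` T)"
    proof (clarsimp simp: inj_on_def)
      fix a b c a' b' c' assume t: "(a, b, c) \<in> T" "(a', b', c') \<in> T" "a + b = a' + b'"
      \<comment> \<open>Two minimal triples with equal partial sums can exchange these parts without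
        changing either total. Minimality of both makes the weights of the parts equal, and
        \<open>radix\<close> reads off the parts.\<close>
      have "w (a, b, c) \<le> w (a', b', c)" "w (a', b', c') \<le> w (a, b, c')"
        using t T[OF t(1)] T[OF t(2)] by (auto intro!: least)
      then have "M * (M * r a + r b) = M * (M * r a' + r b')"
        by (simp add: w_def distrib_left mult.assoc)
      moreover have "M > 0" using M T(1)[OF t(1)] by fastforce
      ultimately have "M * r a + r b = M * r a' + r b'" by simp
      then have "r a = r a'" "r b = r b'" using radix[of "r a" "r b" "r a'" "r b'"] M T[OF t(1)] T[OF t(2)] by auto
      then show "a = a' \<and> b = b'" using r T[OF t(1)] T[OF t(2)] by (simp add: inj_on_eq_iff)
    qed
    show "(\<lambda>(a, b). a + b) ` (\<lambda>(x, y, z). (x, y)) ` T \<subseteq> sumset A B" using T by (force simp: sumset_def)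
  qed (use fin in simp)
  moreover have "card ((\<lambda>(x, y, z). (x, z)) ` T) \<le> card (sumset A C)"
  proof (rule card_inj_on_le)
    show "inj_on (\<lambda>(a, b). a + b) ((\<lambda>(x, y, z). (x, z)) ` T)"
    proof (clarsimp simp: inj_on_def)
      fix a b c a' b' c' assume t: "(a, b, c) \<in> T" "(a', b', c') \<in> T" "a + c = a' + c'"
      have "a + b + c = a' + b + c'" "a' + b' + c' = a + b' + c" using t(3)
        by (metis add.assoc add.commute)+
      then have "w (a, b, c) \<le> w (a', b, c')" "w (a', b', c') \<le> w (a, b', c)"
        using t T[OF t(1)] T[OF t(2)] by (auto intro!: least)
      then have eq: "M * (M * r a) + r c = M * (M * r a') + r c'"
        by (simp add: w_def mult.assoc)
      have "M * r a = M * r a'" "r c = r c'" using radix[OF eq] M T[OF t(1)] T[OF t(2)] by auto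
      moreover have "M > 0" using M T(1)[OF t(1)] by fastforce
      ultimately show "a = a' \<and> c = c'" using r T[OF t(1)] T[OF t(2)] by (simp add: inj_on_eq_iff)
    qed
    show "(\<lambda>(a, b). a + b) ` (\<lambda>(x, y, z). (x, z)) ` T \<subseteq> sumset A C" using T by (force simp: sumset_def)
  qed (use fin in simp)
  moreover have "card ((\<lambda>(x, y, z). (y, z)) ` T) \<le> card (sumset B C)"
  proof (rule card_inj_on_le)
    show "inj_on (\<lambda>(a, b). a + b) ((\<lambda>(x, y, z). (y, z)) ` T)"
    proof (clarsimp simp: inj_on_def)
      fix a b c a' b' c' assume t: "(a, b, c) \<in> T" "(a', b', c') \<in> T" "b + c = b' + c'"
      have "w (a, b, c) \<le> w (a, b', c')" "w (a', b', c') \<le> w (a', b, c)"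
        using t T[OF t(1)] T[OF t(2)] by (auto intro!: least simp: add.assoc)
      then have eq: "M * r b + r c = M * r b' + r c'"
        by (simp add: w_def)
      have "r b = r b'" "r c = r c'" using radix[OF eq] M T[OF t(1)] T[OF t(2)] by auto
      then show "b = b' \<and> c = c'" using r T[OF t(1)] T[OF t(2)] by (simp add: inj_on_eq_iff)
    qed
    show "(\<lambda>(a, b). a + b) ` (\<lambda>(x, y, z). (y, z)) ` T \<subseteq> sumset B C" using T by (force simp: sumset_def)
  qed (use fin in simp)
  ultimately have "card ((\<lambda>(x, y, z). (x, y)) ` T) * (card ((\<lambda>(x, y, z). (x, z)) ` T) * card ((\<lambda>(x, y, z). (y, z)) ` T))
      \<le> card (sumset A B) * (card (sumset A C) * card (sumset B C))"
    by (intro mult_le_mono)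
  then show ?thesis using loomis_whitney[OF finT] unfolding cardT by linarith
qed

text \<open>The least \<open>D\<close> that passes the count in \<open>few_shifts_bound\<close>:
  vanishing to order \<open>2 * k + 1\<close> with \<open>2 * k + 2\<close> functions requires
  \<open>k * (2 * k + 1) * (2 * k) < 2 * D\<close>.\<close>

definition quadratic_degree :: "nat \<Rightarrow> nat" where
  "quadratic_degree k = k\<^sup>2 * (2 * k + 1) + 1"

lemma sum_arith_lessThan: "2 * (\<Sum>l<M. D + k * l) = 2 * M * D + k * (M * (M - 1))" for D k M :: nat
proof -
  have "2 * (\<Sum>l<M. l) = M * (M - 1)"
  proof (induction M)
    case (Suc M)
    then show ?case by (cases M) auto
  qed simp
  then have "2 * (\<Sum>l<M. k * l) = k * (M * (M - 1))"
    by (simp add: sum_distrib_left[symmetric] mult.left_commute)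
  then show ?thesis by (simp add: sum.distrib distrib_left)
qed

section \<open>Bounds for intersections of translates\<close>

context power_residues
begin

text \<open>All exponent vectors are used: the number of functions is exponential in
  \<open>card A\<close>, their degree only linear. With \<open>d ^ card A\<close> near the square
  root of \<open>q\<close>, the order \<open>M\<close> can have that size up to a logarithm; as
  \<open>N * (d - 1) < q\<close>, the bound on \<open>card B\<close> then has it too, up to
  logarithms.\<close>

lemma many_shifts_bound:
  assumes A: "finite A" "A \<subseteq> K" "A \<noteq> {}"
    and B: "\<And>x a. x \<in> B \<Longrightarrow> a \<in> A \<Longrightarrow> (x + a) ^ N = 1"
    and count: "(\<Sum>l<M. D + card A * l) < d ^ card A * D"
    and small: "d ^ card A * (D + 1 + card A) < q"
  shows "M * card B \<le> D + N * (card A * (d - 1))"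
proof (rule stepanov_bound[where \<omega> = "\<lambda>_. 1" and F = "exponents d A" and A = A])
  obtain b where b: "b \<in> A" using A by blast
  have "d ^ card A \<ge> 1" using d by simp
  then have "1 * (D + 1 + card A) \<le> d ^ card A * (D + 1 + card A)" by (rule mult_le_mono1)
  then have "1 * (D + 1 + card A) < q" using small by (rule le_less_trans)
  moreover have "D > 0" using count by (cases D) auto
  ultimately have card: "card A + 2 \<le> q" by simp
  show "\<forall>e\<in>exponents d A. P e = 0"
    if "\<And>e. e \<in> exponents d A \<Longrightarrow> degree (P e) < D"
      "(\<Sum>e\<in>exponents d A. P e * (\<Prod>a\<in>A. [:a, 1:] ^ (N * e a))) = 0" for P
    by (rule nonvanishing[OF A(1,2) b _ that(1) small card that(2)]) auto
  show "(\<Sum>a\<in>A. e a) \<le> card A * (d - 1)" if "e \<in> exponents d A" for e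
  proof -
    have "(\<Sum>a\<in>A. e a) \<le> (\<Sum>a\<in>A. d - 1)"
      using that by (intro sum_mono) (force simp: exponents_def)
    then show ?thesis by simp
  qed
qed (use A B count in \<open>auto simp: card_exponents\<close>)

text \<open>
  With \<open>u\<^sub>a = (x + a)^N\<close>, the auxiliary polynomial combines \<open>1\<close>, all \<open>u\<^sub>a\<close>, all \<open>u\<^sub>a u\<^sub>b\<close> for the
  fixed \<open>b\<close>, and \<open>u\<^sub>b\<^sub>1 u\<^sub>b\<^sub>2\<close>: these are \<open>2 |A| + 2\<close> functions of degree at most \<open>2 N\<close>, just enough
  to beat the trivial bound \<open>N/|A|\<close>.
\<close>
lemma few_shifts_bound:
  assumes A: "finite A" "A \<subseteq> K" and b: "b \<in> A" "b1 \<in> A" "b2 \<in> A" "b1 \<noteq> b" "b2 \<noteq> b"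
    and distinct: "b1 \<noteq> b2 \<or> d \<ge> 3"
    and B: "\<And>x a. x \<in> B \<Longrightarrow> a \<in> A \<Longrightarrow> (x + a) ^ N = \<omega> a" and \<omega>: "\<And>a. a \<in> A \<Longrightarrow> \<omega> a \<noteq> 0"
    and small: "d ^ card A * (quadratic_degree (card A) + 1 + card A) < q"
  shows "(2 * card A + 1) * card B \<le> quadratic_degree (card A) + N * 2"
proof -
  let ?k = "card A" and ?D = "quadratic_degree (card A)"
  \<comment> \<open>Products of at most two of the functions are indexed by multisets, so that the
    order of the factors is immaterial and distinct products have distinct exponent vectors.\<close>
  define ex where "ex m = (\<lambda>a\<in>A. count m a)" for m
  define MS where "MS = {{#}} \<union> (\<lambda>a. {#a#}) ` A \<union> (\<lambda>a. {#a, b#}) ` A \<union> {{#b1, b2#}}"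
  define F where "F = ex ` MS"
  have MS_sub: "set_mset m \<subseteq> A" if "m \<in> MS" for m using that b by (auto simp: MS_def)
  have size_le: "size m \<le> 2" if "m \<in> MS" for m using that by (auto simp: MS_def)
  have inj: "inj_on ex MS"
  proof (rule inj_onI)
    fix m m' assume m: "m \<in> MS" "m' \<in> MS" "ex m = ex m'"
    show "m = m'"
    proof (rule multiset_eqI)
      fix a
      show "count m a = count m' a"
      proof (cases "a \<in> A")
        case True
        then show ?thesis using fun_cong[OF m(3), of a] by (simp add: ex_def)
      next
        case False
        then show ?thesis using MS_sub m(1,2) by (metis count_inI subsetD)
      qed
    qed
  qed
  have "card MS = 2 * ?k + 2"
  proof -
    have 1: "card ({{#}} \<union> (\<lambda>a. {#a#}) ` A) = 1 + ?k"
      using A by (subst card_Un_disjoint) (auto simp: card_image inj_on_def)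
    have "inj_on (\<lambda>a. {#a, b#}) A" by (auto simp: inj_on_def)
    then have "card ({{#}} \<union> (\<lambda>a. {#a#}) ` A \<union> (\<lambda>a. {#a, b#}) ` A) = 1 + ?k + ?k"
      using A 1 by (subst card_Un_disjoint) (auto simp: card_image)
    moreover have "{#b1, b2#} \<notin> {{#}} \<union> (\<lambda>a. {#a#}) ` A \<union> (\<lambda>a. {#a, b#}) ` A"
    proof
      assume "{#b1, b2#} \<in> {{#}} \<union> (\<lambda>a. {#a#}) ` A \<union> (\<lambda>a. {#a, b#}) ` A"
      then have "size {#b1, b2#} \<le> 1 \<or> b \<in># {#b1, b2#}"
        by (elim UnE imageE) (simp_all only:, auto)
      then show False using b by simp
    qed
    ultimately show ?thesis using A by (simp add: MS_def)
  qed
  then have cardF: "card F = 2 * ?k + 2" by (simp add: F_def card_image[OF inj])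
  have finF: "finite F" using A by (simp add: F_def MS_def)
  have Fsub: "F \<subseteq> insert ((\<lambda>a\<in>A. 0)(b := d)) (exponents d A)"
  proof
    fix e assume "e \<in> F"
    then obtain m where m: "m \<in> MS" "e = ex m" by (auto simp: F_def)
    show "e \<in> insert ((\<lambda>a\<in>A. 0)(b := d)) (exponents d A)"
    proof (cases "\<forall>a\<in>A. count m a < d")
      case True
      then show ?thesis using m by (auto simp: ex_def exponents_def)
    next
      case False
      then obtain a where a: "a \<in> A" "count m a \<ge> d" by (meson not_le)
      have "count m a \<le> 2" using count_le_size[of m a] size_le[OF m(1)] by linarith
      \<comment> \<open>Only a square can reach the exponent \<open>d\<close>, and only for
        \<open>d = 2\<close>. Then \<open>distinct\<close> gives \<open>b1 \<noteq> b2\<close>, so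
        the one square in \<open>MS\<close> is that at \<open>b\<close>, the single extra vector
        that \<open>nonvanishing\<close> admits.\<close>
      then have "d = 2" "count m a = 2" using a d by auto
      then have "m = {#b, b#}" using m(1) distinct by (auto simp: MS_def split: if_splits)
      then have "e = (\<lambda>a\<in>A. 0)(b := d)" using m \<open>d = 2\<close> b by (auto simp: ex_def fun_eq_iff)
      then show ?thesis by simp
    qed
  qed
  have sum_le: "(\<Sum>a\<in>A. e a) \<le> 2" if "e \<in> F" for e
  proof -
    obtain m where m: "m \<in> MS" "e = ex m" using \<open>e \<in> F\<close> by (auto simp: F_def)
    have "(\<Sum>a\<in>A. e a) = (\<Sum>a\<in>A. count m a)" using m by (simp add: ex_def)
    also have "\<dots> = size m"
      unfolding size_multiset_overloaded_eq using A MS_sub[OF m(1)]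
      by (intro sum.mono_neutral_right) (auto simp: not_in_iff)
    finally show ?thesis using size_le[OF m(1)] by simp
  qed
  have "2 * (\<Sum>l<2 * ?k + 1. ?D + ?k * l) < 2 * ((2 * ?k + 2) * ?D)"
    unfolding sum_arith_lessThan by (simp add: quadratic_degree_def algebra_simps power2_eq_square)
  then have count: "(\<Sum>l<2 * ?k + 1. ?D + ?k * l) < card F * ?D" using cardF by simp
  have "d ^ ?k \<ge> 1" using d by simp
  then have "1 * (?D + 1 + ?k) \<le> d ^ ?k * (?D + 1 + ?k)" by (rule mult_le_mono1)
  then have "1 * (?D + 1 + ?k) < q" using small by (rule le_less_trans)
  then have card: "?k + 2 \<le> q" by (simp add: quadratic_degree_def)
  show ?thesis
  proof (rule stepanov_bound[OF A(1) finF B \<omega> sum_le count])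
    show "\<forall>e\<in>F. P e = 0"
      if "\<And>e. e \<in> F \<Longrightarrow> degree (P e) < ?D"
        "(\<Sum>e\<in>F. P e * (\<Prod>a\<in>A. [:a, 1:] ^ (N * e a))) = 0" for P
      by (rule nonvanishing[OF A b(1) Fsub that(1) small card that(2)])
  qed
qed

section \<open>The group of d-th powers and its additive decompositions\<close>

definition S where "S = {x::'k. x ^ N = 1}"

lemma finite_S: "finite S"
proof -
  have "S \<subseteq> {x. poly (monom 1 N - 1) x = 0}" by (auto simp: S_def poly_monom)
  moreover have "monom 1 N - 1 \<noteq> (0::'k poly)"
  proof
    assume "monom 1 N - 1 = (0::'k poly)"
    then have "degree (monom (1::'k) N) = 0" by simp
    then show False using N by (simp add: degree_monom_eq)
  qed
  ultimately show ?thesis using poly_roots_finite finite_subset by blast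
qed

lemma card_S_le: "card S \<le> N"
proof -
  let ?p = "monom 1 N - [:1:] :: 'k poly"
  have deg: "degree ?p = N"
    using N degree_add_eq_left[of "- [:1:]" "monom (1::'k) N"]
    by (simp add: degree_monom_eq del: minus_pCons)
  then have "?p \<noteq> 0" using N by (metis degree_0 less_irrefl)
  have "S = {x. poly ?p x = 0}" by (auto simp: S_def poly_monom)
  then show ?thesis using card_poly_roots_bound[OF \<open>?p \<noteq> 0\<close>] deg by simp
qed

text \<open>A squeeze: \<open>x ^ N - 1\<close> has at most \<open>N\<close> roots, while each fibre
  of \<open>x \<mapsto> x ^ d\<close> on the \<open>d * N\<close> nonzero elements of
  \<open>K\<close> has at most \<open>d\<close> elements, so there are at least \<open>N\<close>
  values.\<close>

lemma image_power_eq_S: "(\<lambda>x. x ^ d) ` (K - {0}) = S" and card_S: "card S = N"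
proof -
  have finK: "finite K" using card_K q by (metis card.infinite nat.distinct(1) add_is_0 zero_neq_one)
  have zero: "0 \<in> K" using q by (simp add: K_def)
  let ?T = "(\<lambda>x. x ^ d) ` (K - {0})"
  have "x ^ d \<in> S" if "x \<in> K - {0}" for x
  proof -
    have "x * x ^ (d * N) = x * 1" using that by (auto simp: K_def q)
    then have "x ^ (d * N) = 1" using that unfolding mult_cancel_left by blast
    then show ?thesis by (simp add: S_def power_mult)
  qed
  then have T_sub: "?T \<subseteq> S" by blast
  have "K - {0} = (\<Union>y\<in>?T. {x \<in> K - {0}. x ^ d = y})" by auto
  then have "card (K - {0}) \<le> (\<Sum>y\<in>?T. card {x \<in> K - {0}. x ^ d = y})"
    using card_UN_le[of ?T "\<lambda>y. {x \<in> K - {0}. x ^ d = y}"] finK by simp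
  also have "\<dots> \<le> (\<Sum>y\<in>?T. d)"
  proof (rule sum_mono)
    fix y :: 'k
    let ?p = "monom 1 d - [:y:]"
    have deg: "degree ?p = d"
      using d degree_add_eq_left[of "- [:y:]" "monom 1 d"]
      by (simp add: degree_monom_eq del: minus_pCons)
    then have "?p \<noteq> 0" using d by auto
    have "card {x \<in> K - {0}. x ^ d = y} \<le> card {x. poly ?p x = 0}"
      using \<open>?p \<noteq> 0\<close> by (intro card_mono poly_roots_finite) (auto simp: poly_monom)
    also have "\<dots> \<le> d" using card_poly_roots_bound[OF \<open>?p \<noteq> 0\<close>] deg by simp
    finally show "card {x \<in> K - {0}. x ^ d = y} \<le> d" .
  qed
  finally have "d * N \<le> d * card ?T" using finK zero by (simp add: card_K q mult.commute)
  then have "N \<le> card ?T" using d by simp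
  then show "?T = S" using card_S_le by (intro card_seteq[OF finite_S T_sub]) simp
  with \<open>N \<le> card ?T\<close> show "card S = N" using card_S_le by simp
qed

lemma S_subset_K: "S \<subseteq> K"
proof
  fix x assume "x \<in> S"
  then have "x ^ (N * d) = 1" by (simp add: S_def power_mult)
  then show "x \<in> K" by (simp add: K_def q mult.commute)
qed

text \<open>On two shifts with \<open>d = 2\<close> the quadratic family would contain two squares,
  but only one is admissible. The third shift comes from the pair itself: for \<open>x\<close> in
  \<open>S\<close>, one of \<open>x + \<delta>\<close> and \<open>x - \<delta>\<close> lies in
  \<open>S\<close>, which rules out one of the four sign patterns at these two points.\<close>

lemma not_sumset_pair:
  assumes d2: "d = 2" and a: "a \<in> K" "b \<in> K" "a \<noteq> b" and Y: "sumset {a, b} Y = S"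
    and q_large: "544 < q"
  shows False
proof -
  define \<delta> where "\<delta> = b - a"
  have sub: "\<delta> \<in> K"
  proof -
    have "(b + - a) ^ q = b ^ q + (- a) ^ q"
      by (rule freshmans_dream'[where n = n]) (simp_all add: prime_CHAR q_eq)
    then show ?thesis using a uminus_mem_K[OF a(1)] by (simp add: \<delta>_def K_def)
  qed
  have \<delta>0: "\<delta> \<noteq> 0" using a by (simp add: \<delta>_def)
  have two: "(2::'k) \<noteq> 0" using of_nat_d d2 by simp
  have ne: "\<delta> \<noteq> - \<delta>"
  proof
    assume "\<delta> = - \<delta>"
    then have "2 * \<delta> = 0" by (metis add.right_inverse mult_2)
    then show False using \<delta>0 two by simp
  qed
  define A where "A = {0, \<delta>, - \<delta>}"
  have A: "finite A" "A \<subseteq> K" "card A = 3"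
    using sub uminus_mem_K[OF sub] \<delta>0 ne q by (auto simp: A_def K_def card_insert_if)
  \<comment> \<open>Here \<open>quadratic_degree 3 = 64\<close> and the order is
    \<open>2 * 3 + 1 = 7\<close>; the size condition \<open>2 ^ 3 * (64 + 1 + 3) < q\<close> is the
    origin of 544.\<close>
  have bound: "7 * card V \<le> 64 + N * 2"
    if "\<And>x u. x \<in> V \<Longrightarrow> u \<in> A \<Longrightarrow> (x + u) ^ N = \<omega> u" "\<And>u. u \<in> A \<Longrightarrow> \<omega> u \<noteq> 0" for V \<omega>
    using few_shifts_bound[OF A(1,2), of 0 \<delta> "-\<delta>" V \<omega>] that \<delta>0 ne q_large
    by (simp add: A(3) quadratic_degree_def d2) (simp add: A_def)
  have square: "x ^ N = 1 \<or> x ^ N = -1" if "x \<in> K" "x \<noteq> 0" for x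
  proof -
    have "x * x ^ (2 * N) = x * 1" using that d2 by (simp add: K_def q)
    then have "x ^ (2 * N) = 1" using that unfolding mult_cancel_left by blast
    then have "(x ^ N)\<^sup>2 = 1" by (simp add: power_mult[symmetric] mult.commute)
    then show ?thesis by (simp add: power2_eq_1_iff)
  qed
  define V1 where "V1 = {x. \<forall>u\<in>A. (x + u) ^ N = 1}"
  define V2 where "V2 = {x. \<forall>u\<in>A. (x + u) ^ N = (if u = - \<delta> then -1 else 1)}"
  define V3 where "V3 = {x. \<forall>u\<in>A. (x + u) ^ N = (if u = \<delta> then -1 else 1)}"
  have "7 * card V1 \<le> 64 + N * 2" by (rule bound[of _ "\<lambda>_. 1"]) (auto simp: V1_def)
  moreover have "7 * card V2 \<le> 64 + N * 2"
    by (rule bound[of _ "\<lambda>u. if u = - \<delta> then -1 else 1"]) (auto simp: V2_def)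
  moreover have "7 * card V3 \<le> 64 + N * 2"
    by (rule bound[of _ "\<lambda>u. if u = \<delta> then -1 else 1"]) (auto simp: V3_def)
  \<comment> \<open>At \<open>\<delta>\<close> and \<open>- \<delta>\<close> one translate is zero
    and has no sign, so these two points are counted separately.\<close>
  moreover have "S \<subseteq> V1 \<union> V2 \<union> V3 \<union> {\<delta>, - \<delta>}"
  proof
    fix x assume x: "x \<in> S"
    then obtain y where y: "y \<in> Y" "x = a + y \<or> x = b + y" unfolding Y[symmetric] by (auto simp: sumset_def)
    have "a + y \<in> S" "b + y \<in> S" using y(1) unfolding Y[symmetric] by (auto simp: sumset_def)
    then have 1: "(x + \<delta>) ^ N = 1 \<or> (x + - \<delta>) ^ N = 1"
      using y(2) by (auto simp: \<delta>_def S_def algebra_simps)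
    have "x \<in> K" using x S_subset_K by auto
    have mem: "x + u \<in> K" if "u \<in> K" for u
    proof -
      have "(x + u) ^ q = x ^ q + u ^ q"
        by (rule freshmans_dream'[where n = n]) (simp_all add: prime_CHAR q_eq)
      then show ?thesis using \<open>x \<in> K\<close> that by (simp add: K_def)
    qed
    have 2: "(x + \<delta>) ^ N = 1 \<or> (x + \<delta>) ^ N = -1 \<or> x = - \<delta>"
      using square[OF mem[OF sub]] by (auto simp: eq_neg_iff_add_eq_0)
    have 3: "(x + - \<delta>) ^ N = 1 \<or> (x + - \<delta>) ^ N = -1 \<or> x = \<delta>"
      using square[OF mem[OF uminus_mem_K[OF sub]]] by auto
    have "x ^ N = 1" using x by (simp add: S_def)
    then show "x \<in> V1 \<union> V2 \<union> V3 \<union> {\<delta>, - \<delta>}"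
      using 1 2 3 \<delta>0 ne by (auto simp: V1_def V2_def V3_def A_def)
  qed
  then have "card S \<le> card V1 + card V2 + card V3 + 2"
  proof -
    have fin: "finite V1" "finite V2" "finite V3"
      by (rule finite_subset[OF _ finite_S], use \<delta>0 in \<open>force simp: V1_def V2_def V3_def A_def S_def\<close>)+
    have "card S \<le> card (V1 \<union> V2 \<union> V3 \<union> {\<delta>, - \<delta>})"
      using fin \<open>S \<subseteq> _\<close> by (intro card_mono) auto
    also have "\<dots> \<le> card V1 + card V2 + card V3 + card {\<delta>, - \<delta>}"
      by (meson card_Un_le add_le_mono le_trans le_refl)
    also have "card {\<delta>, - \<delta>} \<le> 2" by (simp add: card_insert_if)
    finally show ?thesis by simp
  qed
  \<comment> \<open>The three bounds add up to \<open>7 * (N - 2) \<le> 192 + 6 * N\<close>, that is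
    \<open>N \<le> 206\<close>.\<close>
  moreover have "N \<ge> 272" using q d2 q_large by simp
  ultimately show False using card_S by linarith
qed

text \<open>With \<open>k = card Xs\<close>, covering \<open>S\<close> needs
  \<open>card Y \<ge> N / k\<close>, while \<open>few_shifts_bound\<close> gives about
  \<open>2 * N / (2 * k + 1)\<close>. After cross-multiplication the terms \<open>2 * k * N\<close>
  cancel, and \<open>N \<le> k * quadratic_degree k\<close> contradicts
  \<open>N_large\<close>.\<close>

lemma not_sumset_small:
  assumes Xs: "finite Xs" "Xs \<subseteq> K" "card Xs \<ge> 2" and Y: "finite Y" "sumset Xs Y = S"
    and small: "d ^ card Xs * (quadratic_degree (card Xs) + 1 + card Xs) < q"
    and N_large: "card Xs * quadratic_degree (card Xs) < N" and q_large: "544 < q"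
  shows False
proof (cases "card Xs = 2 \<and> d = 2")
  case True
  then obtain a b where "Xs = {a, b}" "a \<noteq> b" by (meson card_2_iff)
  then show ?thesis using not_sumset_pair[of a b Y] True Xs Y q_large by simp
next
  case False
  let ?k = "card Xs"
  obtain b where b: "b \<in> Xs" using Xs by fastforce
  have "card (Xs - {b}) = ?k - 1" using b Xs by simp
  have "\<exists>b1 b2. b1 \<in> Xs \<and> b2 \<in> Xs \<and> b1 \<noteq> b \<and> b2 \<noteq> b \<and> (b1 \<noteq> b2 \<or> d \<ge> 3)"
  proof (cases "?k \<ge> 3")
    case True
    then have "2 \<le> card (Xs - {b})" using \<open>card (Xs - {b}) = ?k - 1\<close> by simp
    then obtain Z where "Z \<subseteq> Xs - {b}" "card Z = 2" by (meson obtain_subset_with_card_n)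
    then show ?thesis by (auto simp: card_2_iff)
  next
    case k: False
    \<comment> \<open>With only two shifts \<open>b1 = b2\<close> is forced; the extra product is
      then a square away from \<open>b\<close>, an ordinary exponent vector since
      \<open>d \<ge> 3\<close>.\<close>
    then have "d \<ge> 3" using False d Xs by linarith
    moreover have "Xs - {b} \<noteq> {}" using \<open>card (Xs - {b}) = ?k - 1\<close> Xs by (intro notI) simp
    ultimately show ?thesis by blast
  qed
  then obtain b1 b2 where b12: "b1 \<in> Xs" "b2 \<in> Xs" "b1 \<noteq> b" "b2 \<noteq> b" "b1 \<noteq> b2 \<or> d \<ge> 3" by blast
  have mem: "(y + a) ^ N = 1" if "y \<in> Y" "a \<in> Xs" for y a
  proof -
    have "a + y \<in> S" unfolding Y(2)[symmetric] using that by (auto simp: sumset_def)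
    then show ?thesis by (simp add: S_def add.commute)
  qed
  have "(2 * ?k + 1) * card Y \<le> quadratic_degree ?k + N * 2"
    by (rule few_shifts_bound[OF Xs(1,2) b b12, of Y "\<lambda>_. 1"]) (use mem small in auto)
  then have "?k * ((2 * ?k + 1) * card Y) \<le> ?k * (quadratic_degree ?k + N * 2)" by simp
  moreover have "N \<le> ?k * card Y" using card_S card_sumset_le[OF Xs(1) Y(1)] Y(2) by simp
  then have "(2 * ?k + 1) * N \<le> (2 * ?k + 1) * (?k * card Y)" by (rule mult_le_mono2)
  ultimately have "(2 * ?k + 1) * N \<le> ?k * (quadratic_degree ?k + N * 2)"
    by (simp only: mult.left_commute)
  then have "N \<le> ?k * quadratic_degree ?k" by (simp add: algebra_simps)
  then show False using N_large by simp
qed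

text \<open>Each pairwise sum \<open>Y\<close> is complemented by the third set \<open>Z\<close>, as
  \<open>Z + Y = S\<close>. Fewer than \<open>m\<close> elements in \<open>Z\<close> are excluded by
  \<open>not_sumset_small\<close>; otherwise any \<open>m\<close> of them bound \<open>Y\<close>.
  The cube and the square in \<open>large\<close> come from inserting the three bounds in Ruzsa's
  inequality.\<close>

lemma no_ternary_decomposition:
  assumes sub: "A \<subseteq> K" "B \<subseteq> K" "C \<subseteq> K" and card: "card A \<ge> 2" "card B \<ge> 2" "card C \<ge> 2"
    and S: "S = sumset A (sumset B C)"
    and few: "\<And>k. 2 \<le> k \<Longrightarrow> k < m \<Longrightarrow> d ^ k * (quadratic_degree k + 1 + k) < q"
      "\<And>k. 2 \<le> k \<Longrightarrow> k < m \<Longrightarrow> k * quadratic_degree k < N" "544 < q"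
    and m: "m > 0" "(\<Sum>l<M. D + m * l) < d ^ m * D" "d ^ m * (D + 1 + m) < q"
    and large: "(D + N * (m * (d - 1))) ^ 3 < M ^ 3 * N\<^sup>2"
  shows False
proof -
  have finK: "finite K" using card_K q by (metis card.infinite nat.distinct(1) add_is_0 zero_neq_one)
  then have fin: "finite A" "finite B" "finite C" using sub by (blast intro: finite_subset)+
  let ?U = "D + N * (m * (d - 1))"
  have bound: "M * card Y \<le> ?U" if Z: "Z \<subseteq> K" "card Z \<ge> 2" and Y: "finite Y" "sumset Z Y = S" for Z Y
  proof -
    have "finite Z" using Z(1) finK finite_subset by auto
    have "\<not> card Z < m" using not_sumset_small[OF \<open>finite Z\<close> Z Y] few Z(2) by blast
    then obtain Z' where Z': "Z' \<subseteq> Z" "card Z' = m" by (meson not_less obtain_subset_with_card_n)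
    have "(y + a) ^ N = 1" if "y \<in> Y" "a \<in> Z'" for y a
    proof -
      have "a + y \<in> S" unfolding Y(2)[symmetric] using that Z' by (auto simp: sumset_def)
      then show ?thesis by (simp add: S_def add.commute)
    qed
    moreover have "finite Z'" "Z' \<subseteq> K" "Z' \<noteq> {}"
      using Z' m(1) Z(1) \<open>finite Z\<close> finite_subset by auto
    ultimately show ?thesis using many_shifts_bound[of Z' Y D M] m Z'(2) by simp
  qed
  have "M * card (sumset B C) \<le> ?U" by (rule bound[OF sub(1) card(1)]) (use fin S in auto)
  moreover have "M * card (sumset A C) \<le> ?U"
    by (rule bound[OF sub(2) card(2)]) (use fin S in \<open>auto simp: sumset_assoc[symmetric] sumset_commute[of B A]\<close>)
  moreover have "M * card (sumset A B) \<le> ?U"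
    by (rule bound[OF sub(3) card(3)]) (use fin S in \<open>auto simp: sumset_commute[of C] sumset_assoc\<close>)
  ultimately have "(M * card (sumset A B)) * ((M * card (sumset A C)) * (M * card (sumset B C))) \<le> ?U * (?U * ?U)"
    by (intro mult_le_mono)
  then have "M ^ 3 * (card (sumset A B) * (card (sumset A C) * card (sumset B C))) \<le> ?U ^ 3"
    by (simp add: power3_eq_cube mult_ac)
  moreover have "N\<^sup>2 \<le> (card S)\<^sup>2" by (simp add: card_S)
  then have "N\<^sup>2 \<le> card (sumset A B) * (card (sumset A C) * card (sumset B C))"
    using card_sumset3_squared_le[OF fin] unfolding S by linarith
  then have "M ^ 3 * N\<^sup>2 \<le> M ^ 3 * (card (sumset A B) * (card (sumset A C) * card (sumset B C)))" by simp
  ultimately show False using large by linarith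
qed

end

section \<open>Transfer to a field type\<close>

text \<open>Numerical conditions free of \<open>\<epsilon>\<close> and \<open>\<delta>\<close>:
  being a counterexample thereby becomes a property of a ring record without parameters, as the
  closed term \<open>critical_field\<close> requires.\<close>

definition admissible :: "nat \<Rightarrow> nat \<Rightarrow> bool" where
  "admissible q d \<longleftrightarrow> 544 < q \<and> (\<exists>m M D. m > 0 \<and>
     (\<forall>k. 2 \<le> k \<and> k < m \<longrightarrow> d ^ k * (quadratic_degree k + 1 + k) < q \<and>
        k * quadratic_degree k < (q - 1) div d) \<and>
     (\<Sum>l<M. D + m * l) < d ^ m * D \<and> d ^ m * (D + 1 + m) < q \<and>
     (D + (q - 1) div d * (m * (d - 1))) ^ 3 < M ^ 3 * ((q - 1) div d)\<^sup>2)"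

lemma finite_field_CHAR_dvd: "CHAR('f::finite_field) dvd card (UNIV :: 'f set)"
proof -
  have "(\<Sum>y\<in>(UNIV :: 'f set). y + 1) = (\<Sum>y\<in>UNIV. y)"
    by (rule sum.reindex_bij_witness[of _ "\<lambda>y. y - 1" "\<lambda>y. y + 1"]) auto
  then have "of_nat (card (UNIV :: 'f set)) = (0 :: 'f)" by (simp add: sum.distrib)
  then show ?thesis by (simp add: of_nat_eq_0_iff_char_dvd)
qed

lemma finite_field_no_ternary_decomposition:
  fixes A B C :: "'f::finite_field set"
  assumes p: "prime p" "card (UNIV :: 'f set) = p ^ n" and d: "d dvd card (UNIV :: 'f set) - 1" "2 \<le> d"
    and adm: "admissible (card (UNIV :: 'f set)) d"
    and card: "card A \<ge> 2" "card B \<ge> 2" "card C \<ge> 2"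
    and eq: "(\<lambda>x. x ^ d) ` (UNIV - {0}) = sumset A (sumset B C)"
  shows False
proof -
  let ?q = "card (UNIV :: 'f set)"
  define N where "N = (?q - 1) div d"
  have q544: "?q > 544" using adm by (simp add: admissible_def)
  have q: "?q = d * N + 1" using d q544 by (simp add: N_def)
  have CHAR: "CHAR('f) = p"
  proof -
    have "CHAR('f) dvd p ^ n" using finite_field_CHAR_dvd[where ?'f = 'f] p by simp
    then have "CHAR('f) dvd p" using prime_dvd_power[OF CHAR_prime] by blast
    then show ?thesis using p(1) CHAR_prime primes_dvd_imp_eq by blast
  qed
  interpret power_residues "range to_ac :: 'f alg_closure set" ?q d N n
  proof
    show "range to_ac = {x :: 'f alg_closure. x ^ ?q = x}"
    proof (rule card_seteq)
      let ?p = "monom 1 ?q - monom 1 1 :: 'f alg_closure poly"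
      have "degree ?p = ?q"
        using q544 degree_add_eq_left[of "- monom 1 1" "monom (1::'f alg_closure) ?q"]
        by (simp add: degree_monom_eq)
      then have "?p \<noteq> 0" using q544 by (metis degree_0 less_nat_zero_code)
      have roots: "{x. x ^ ?q = x} = {x. poly ?p x = 0}" by (auto simp: poly_monom)
      show "finite {x :: 'f alg_closure. x ^ ?q = x}"
        unfolding roots by (rule poly_roots_finite) fact
      show "range to_ac \<subseteq> {x :: 'f alg_closure. x ^ ?q = x}"
        using finite_field_power_card_eq_same by (auto simp flip: to_ac_power)
      have "card {x :: 'f alg_closure. x ^ ?q = x} \<le> ?q"
        unfolding roots using card_poly_roots_bound[OF \<open>?p \<noteq> 0\<close>] \<open>degree ?p = ?q\<close> by simp
      then show "card {x :: 'f alg_closure. x ^ ?q = x} \<le> card (range to_ac :: 'f alg_closure set)"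
        by (simp add: card_image inj_to_ac)
    qed
    show "card (range to_ac :: 'f alg_closure set) = ?q" by (simp add: card_image inj_to_ac)
    show "prime CHAR('f alg_closure)" "?q = CHAR('f alg_closure) ^ n" using p CHAR by simp_all
    show "2 \<le> d" "?q = d * N + 1" by fact+
    show "N > 0" using q q544 by (intro Nat.gr0I) simp
  qed
  have "S = (\<lambda>x. x ^ d) ` (range to_ac - {0})" by (simp add: image_power_eq_S)
  also have "\<dots> = to_ac ` (\<lambda>x. x ^ d) ` (UNIV - {0 :: 'f})" by (force simp: image_iff)
  also have "\<dots> = sumset (to_ac ` A) (sumset (to_ac ` B) (to_ac ` C))"
    unfolding eq by (force simp: sumset_def image_iff)
  finally have S: "S = sumset (to_ac ` A) (sumset (to_ac ` B) (to_ac ` C))" .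
  have inj: "inj_on to_ac U" for U :: "'f set" using inj_to_ac by (rule inj_on_subset) simp
  from adm obtain m M D where "m > 0"
     "\<And>k. 2 \<le> k \<Longrightarrow> k < m \<Longrightarrow> d ^ k * (quadratic_degree k + 1 + k) < ?q"
     "\<And>k. 2 \<le> k \<Longrightarrow> k < m \<Longrightarrow> k * quadratic_degree k < N"
     "(\<Sum>l<M. D + m * l) < d ^ m * D" "d ^ m * (D + 1 + m) < ?q"
     "(D + N * (m * (d - 1))) ^ 3 < M ^ 3 * N\<^sup>2"
    unfolding admissible_def N_def by blast
  then show False
    using card q544 S
    by (intro no_ternary_decomposition[of "to_ac ` A" "to_ac ` B" "to_ac ` C" m D M])
       (auto simp: card_image[OF inj])
qed

definition has_ternary_decomposition :: "('a, 'm) ring_scheme \<Rightarrow> bool" where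
  "has_ternary_decomposition F \<longleftrightarrow> (\<exists>p n d A B C. prime p \<and> card (carrier F) = p ^ n \<and>
     d dvd card (carrier F) - 1 \<and> 2 \<le> d \<and> admissible (card (carrier F)) d \<and>
     A \<subseteq> carrier F \<and> B \<subseteq> carrier F \<and> C \<subseteq> carrier F \<and> card A \<ge> 2 \<and> card B \<ge> 2 \<and> card C \<ge> 2 \<and>
     nonzero_powers F d = A <+>\<^bsub>F\<^esub> B <+>\<^bsub>F\<^esub> C)"

lemma set_add_eq_image: "A <+>\<^bsub>F\<^esub> B = (\<lambda>(a, b). a \<oplus>\<^bsub>F\<^esub> b) ` (A \<times> B)"
  by (auto simp: set_add_defs)

text \<open>Moves a counterexample from an arbitrary carrier type to \<open>nat\<close>, the one
  type over which \<open>critical_field\<close> chooses.\<close>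

lemma has_ternary_decomposition_nat_copy:
  fixes F :: "('a, 'm) ring_scheme"
  assumes "field F" and fin: "finite (carrier F)" and dec: "has_ternary_decomposition F"
  shows "\<exists>G :: nat ring. field G \<and> finite (carrier G) \<and> has_ternary_decomposition G"
proof -
  interpret F: field F by fact
  obtain h :: "'a \<Rightarrow> nat" where h: "inj_on h (carrier F)"
    using finite_imp_inj_to_nat_seg[OF fin] by blast
  define G where "G = image_ring h F"
  interpret G: field G unfolding G_def by (rule F.inj_imp_image_ring_is_field[OF h])
  have carrier: "carrier G = h ` carrier F" by (simp add: G_def image_ring_carrier)
  have hom: "h \<in> ring_hom F G"
    using inj_imp_image_ring_iso[OF h] by (simp add: G_def ring_iso_def)
  have card: "card (carrier G) = card (carrier F)" by (simp add: carrier card_image[OF h])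
  have zero: "h \<zero>\<^bsub>F\<^esub> = \<zero>\<^bsub>G\<^esub>" by (simp add: G_def image_ring_zero)
  have pow: "h (x [^]\<^bsub>F\<^esub> k) = h x [^]\<^bsub>G\<^esub> k" if "x \<in> carrier F" for x and k :: nat
    by (induction k) (use that in \<open>auto simp: ring_hom_one[OF hom] ring_hom_mult[OF hom]\<close>)
  have nz: "h x = \<zero>\<^bsub>G\<^esub> \<longleftrightarrow> x = \<zero>\<^bsub>F\<^esub>" if "x \<in> carrier F" for x
    using that h zero by (metis F.zero_closed inj_on_eq_iff)
  have powers: "nonzero_powers G k = h ` nonzero_powers F k" for k
    unfolding nonzero_powers_def carrier
  proof (intro equalityI subsetI)
    fix y assume "y \<in> {x [^]\<^bsub>G\<^esub> k |x. x \<in> h ` carrier F - {\<zero>\<^bsub>G\<^esub>}}"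
    then obtain x where "x \<in> carrier F" "h x \<noteq> \<zero>\<^bsub>G\<^esub>" "y = h x [^]\<^bsub>G\<^esub> k" by auto
    then show "y \<in> h ` {x [^]\<^bsub>F\<^esub> k |x. x \<in> carrier F - {\<zero>\<^bsub>F\<^esub>}}"
      using pow[of x k] zero by (intro image_eqI[of _ _ "x [^]\<^bsub>F\<^esub> k"]) auto
  next
    fix y assume "y \<in> h ` {x [^]\<^bsub>F\<^esub> k |x. x \<in> carrier F - {\<zero>\<^bsub>F\<^esub>}}"
    then obtain x where "x \<in> carrier F" "x \<noteq> \<zero>\<^bsub>F\<^esub>" "y = h (x [^]\<^bsub>F\<^esub> k)" by auto
    then show "y \<in> {x [^]\<^bsub>G\<^esub> k |x. x \<in> h ` carrier F - {\<zero>\<^bsub>G\<^esub>}}" using pow[of x k] nz[of x] by auto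
  qed
  have add: "h ` (A <+>\<^bsub>F\<^esub> B) = h ` A <+>\<^bsub>G\<^esub> h ` B" if "A \<subseteq> carrier F" "B \<subseteq> carrier F" for A B
  proof -
    have "h ` (A <+>\<^bsub>F\<^esub> B) = (\<lambda>(a, b). h (a \<oplus>\<^bsub>F\<^esub> b)) ` (A \<times> B)"
      by (simp add: set_add_eq_image image_image case_prod_unfold)
    also have "\<dots> = (\<lambda>(a, b). h a \<oplus>\<^bsub>G\<^esub> h b) ` (A \<times> B)"
      using that by (intro image_cong refl) (auto simp: ring_hom_add[OF hom] subset_iff)
    also have "\<dots> = h ` A <+>\<^bsub>G\<^esub> h ` B" by (force simp: set_add_eq_image)
    finally show ?thesis .
  qed
  from dec obtain p n d A B C where dec: "prime p" "card (carrier F) = p ^ n"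
     "d dvd card (carrier F) - 1" "2 \<le> d" "admissible (card (carrier F)) d"
     "A \<subseteq> carrier F" "B \<subseteq> carrier F" "C \<subseteq> carrier F" "card A \<ge> 2" "card B \<ge> 2" "card C \<ge> 2"
     "nonzero_powers F d = A <+>\<^bsub>F\<^esub> B <+>\<^bsub>F\<^esub> C"
    unfolding has_ternary_decomposition_def by blast
  have AB: "A <+>\<^bsub>F\<^esub> B \<subseteq> carrier F" using dec(6,7) by (auto simp: set_add_eq_image subset_iff)
  have "nonzero_powers G d = h ` A <+>\<^bsub>G\<^esub> h ` B <+>\<^bsub>G\<^esub> h ` C"
    unfolding powers dec(12) using dec by (simp add: add AB)
  moreover have "card (h ` U) = card U" if "U \<subseteq> carrier F" for U
    using h that by (meson card_image inj_on_subset)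
  ultimately have "has_ternary_decomposition G"
    unfolding has_ternary_decomposition_def card unfolding carrier
    using dec(1-11) image_mono[of _ "carrier F" h] by metis
  then show ?thesis using G.field_axioms fin carrier by (intro exI[of _ G]) auto
qed

text \<open>
  Polynomials and algebraic closures are only available over fields that are types, and no type
  can be introduced for a variable finite field. It suffices to have the type of a single field,
  a counterexample if there is one at all; this is a closed term.
\<close>
definition critical_field :: "nat ring" where
  "critical_field = (SOME F. field F \<and> finite (carrier F) \<and>
     ((\<exists>G :: nat ring. field G \<and> finite (carrier G) \<and> has_ternary_decomposition G) \<longrightarrow>
      has_ternary_decomposition F))"

text \<open>Gives \<open>critical_field\<close> a value when there is no counterexample; a copy of
  the field of two elements serves.\<close>

lemma finite_nat_field_exists: "\<exists>F :: nat ring. field F \<and> finite (carrier F)"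
proof -
  let ?R = "ring_of_type_algebra :: bit ring"
  interpret R: field ?R by (rule field_from_type_algebra)
  have "inj_on (\<lambda>b::bit. of_bool (b = 1) :: nat) (carrier ?R)" by (auto simp: inj_on_def)
  then have "field (image_ring (\<lambda>b::bit. of_bool (b = 1) :: nat) ?R)"
    by (rule R.inj_imp_image_ring_is_field)
  moreover have "finite (carrier (image_ring (\<lambda>b::bit. of_bool (b = 1) :: nat) ?R))"
    by (rule finite_subset[of _ "{0, 1}"]) (auto simp: image_ring_carrier)
  ultimately show ?thesis by blast
qed

lemma critical_field:
  "field critical_field" "finite (carrier critical_field)"
  "\<And>G :: nat ring. field G \<Longrightarrow> finite (carrier G) \<Longrightarrow> has_ternary_decomposition G \<Longrightarrow>
     has_ternary_decomposition critical_field"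
proof -
  have "\<exists>F :: nat ring. field F \<and> finite (carrier F) \<and>
     ((\<exists>G :: nat ring. field G \<and> finite (carrier G) \<and> has_ternary_decomposition G) \<longrightarrow>
      has_ternary_decomposition F)"
    using finite_nat_field_exists by blast
  from someI_ex[OF this, folded critical_field_def]
  show "field critical_field" "finite (carrier critical_field)"
    "\<And>G :: nat ring. field G \<Longrightarrow> finite (carrier G) \<Longrightarrow> has_ternary_decomposition G \<Longrightarrow>
       has_ternary_decomposition critical_field" by blast+
qed

section \<open>The critical field as a type\<close>

typedef critical = "carrier critical_field"
proof -
  interpret cf: field critical_field by (rule critical_field)
  show ?thesis using cf.zero_closed by blast
qed

lemmas Rep_critical_simps [simp] = Rep_critical Rep_critical_inverse Abs_critical_inverse

instantiation critical :: field
begin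

definition "0 = Abs_critical \<zero>\<^bsub>critical_field\<^esub>"
definition "1 = Abs_critical \<one>\<^bsub>critical_field\<^esub>"
definition "x + y = Abs_critical (Rep_critical x \<oplus>\<^bsub>critical_field\<^esub> Rep_critical y)"
definition "x * y = Abs_critical (Rep_critical x \<otimes>\<^bsub>critical_field\<^esub> Rep_critical y)"
definition "- x = Abs_critical (\<ominus>\<^bsub>critical_field\<^esub> Rep_critical x)"
definition "x - y = x + - (y :: critical)"
definition "inverse x = (if x = 0 then 0 else Abs_critical (inv\<^bsub>critical_field\<^esub> Rep_critical x))"
definition "x div y = x * inverse (y :: critical)"

instance
proof
  interpret cf: field critical_field by (rule critical_field)
  note defs = zero_critical_def one_critical_def plus_critical_def times_critical_def uminus_critical_def
    minus_critical_def divide_critical_def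
  have eq: "x = y \<longleftrightarrow> Rep_critical x = Rep_critical y" for x y :: critical
    by (simp add: Rep_critical_inject)
  fix x y z :: critical
  show "x * y * z = x * (y * z)" by (simp add: defs cf.m_assoc)
  show "x * y = y * x" by (simp add: defs cf.m_comm)
  show "1 * x = x" by (simp add: defs)
  show "x + y + z = x + (y + z)" by (simp add: defs cf.a_assoc)
  show "x + y = y + x" by (simp add: defs cf.a_comm)
  show "0 + x = x" by (simp add: defs)
  show "- x + x = 0" by (simp add: defs cf.l_neg)
  show "x - y = x + - y" by (simp add: defs)
  show "(x + y) * z = x * z + y * z" by (simp add: defs cf.l_distr)
  show "(0 :: critical) \<noteq> 1" by (simp add: eq defs)
  show "x div y = x * inverse y" by (simp add: defs)
  show "inverse x * x = 1" if "x \<noteq> 0"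
  proof -
    have "Rep_critical x \<noteq> \<zero>\<^bsub>critical_field\<^esub>" using that by (simp add: eq zero_critical_def)
    then have "Rep_critical x \<in> Units critical_field" by (simp add: cf.field_Units)
    then show ?thesis using that by (simp add: inverse_critical_def times_critical_def one_critical_def)
  qed
  show "inverse (0 :: critical) = 0" by (simp add: inverse_critical_def)
qed

end

lemma UNIV_critical: "(UNIV :: critical set) = Abs_critical ` carrier critical_field"
  by (metis Abs_critical_cases UNIV_eq_I image_eqI)

instance critical :: finite_field
  by (rule finite_fieldI) (simp add: UNIV_critical critical_field(2))

lemma not_has_ternary_decomposition:
  fixes F :: "('a, 'm) ring_scheme"
  assumes "field F" "finite (carrier F)"
  shows "\<not> has_ternary_decomposition F"
proof
  assume "has_ternary_decomposition F"
  interpret cf: field critical_field by (rule critical_field)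
  from \<open>has_ternary_decomposition F\<close> have "has_ternary_decomposition critical_field"
    using has_ternary_decomposition_nat_copy[OF assms] critical_field(3) by blast
  then obtain p n d A B C where dec: "prime p" "card (carrier critical_field) = p ^ n"
     "d dvd card (carrier critical_field) - 1" "2 \<le> d" "admissible (card (carrier critical_field)) d"
     "A \<subseteq> carrier critical_field" "B \<subseteq> carrier critical_field" "C \<subseteq> carrier critical_field"
     "card A \<ge> 2" "card B \<ge> 2" "card C \<ge> 2"
     "nonzero_powers critical_field d = A <+>\<^bsub>critical_field\<^esub> B <+>\<^bsub>critical_field\<^esub> C"
    unfolding has_ternary_decomposition_def by blast
  have inj: "inj_on Abs_critical (carrier critical_field)"
    by (rule inj_onI) (metis Abs_critical_inverse)
  have card: "card (UNIV :: critical set) = card (carrier critical_field)"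
    by (simp add: UNIV_critical card_image[OF inj])
  have pow: "Abs_critical (x [^]\<^bsub>critical_field\<^esub> k) = Abs_critical x ^ k" if "x \<in> carrier critical_field" for x and k :: nat
  proof (induction k)
    case (Suc k)
    have "Abs_critical (x [^]\<^bsub>critical_field\<^esub> Suc k) =
        Abs_critical x * Abs_critical (x [^]\<^bsub>critical_field\<^esub> k)"
      using that by (simp add: times_critical_def cf.m_comm)
    then show ?case by (simp only: Suc.IH power_Suc)
  qed (simp add: one_critical_def)
  have powers: "(\<lambda>x. x ^ d) ` (UNIV - {0 :: critical}) = Abs_critical ` nonzero_powers critical_field d"
  proof -
    have "UNIV - {0 :: critical} = Abs_critical ` (carrier critical_field - {\<zero>\<^bsub>critical_field\<^esub>})"
      unfolding UNIV_critical zero_critical_def using inj by (subst inj_on_image_set_diff[of _ "carrier critical_field"]) auto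
    moreover have "nonzero_powers critical_field d =
        (\<lambda>x. x [^]\<^bsub>critical_field\<^esub> d) ` (carrier critical_field - {\<zero>\<^bsub>critical_field\<^esub>})"
      by (auto simp: nonzero_powers_def)
    ultimately show ?thesis using pow by (simp add: image_image)
  qed
  have add: "Abs_critical ` (U <+>\<^bsub>critical_field\<^esub> V) = sumset (Abs_critical ` U) (Abs_critical ` V)"
    if "U \<subseteq> carrier critical_field" "V \<subseteq> carrier critical_field" for U V
  proof -
    have "Abs_critical ` (U <+>\<^bsub>critical_field\<^esub> V) = (\<lambda>(a, b). Abs_critical (a \<oplus>\<^bsub>critical_field\<^esub> b)) ` (U \<times> V)"
      by (simp add: set_add_eq_image image_image case_prod_unfold)
    also have "\<dots> = (\<lambda>(a, b). Abs_critical a + Abs_critical b) ` (U \<times> V)"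
      using that by (intro image_cong refl) (auto simp: plus_critical_def subset_iff)
    also have "\<dots> = sumset (Abs_critical ` U) (Abs_critical ` V)" by (force simp: sumset_def)
    finally show ?thesis .
  qed
  have AB: "A <+>\<^bsub>critical_field\<^esub> B \<subseteq> carrier critical_field"
    using dec(6,7) by (auto simp: set_add_eq_image subset_iff)
  have "(\<lambda>x. x ^ d) ` (UNIV - {0 :: critical}) =
      sumset (Abs_critical ` A) (sumset (Abs_critical ` B) (Abs_critical ` C))"
    unfolding powers dec(12) using dec by (simp add: add AB sumset_assoc)
  moreover have "card (Abs_critical ` U) = card U" if "U \<subseteq> carrier critical_field" for U
    using inj that by (meson card_image inj_on_subset)
  ultimately show False
    using dec card by (intro finite_field_no_ternary_decomposition[of p n d "Abs_critical ` A" "Abs_critical ` B" "Abs_critical ` C"]) auto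
qed

section \<open>Asymptotics\<close>

lemma ln_power_less_powr:
  fixes c e :: real
  assumes c: "c > 0" and e: "e > 0" and r: "r > 0"
  shows "\<exists>x0\<ge>1. \<forall>x>x0. c * (1 + ln x) ^ r < x powr e"
proof -
  \<comment> \<open>With this \<open>a\<close> the \<open>r\<close>-th power of
    \<open>x powr a\<close> is \<open>x powr (e / 2)\<close>; the other half of the exponent beats
    the constant.\<close>
  define a where "a = e / (2 * r)"
  have a: "a > 0" using e r by (simp add: a_def)
  define b where "b = c * (1 + 1 / a) ^ r"
  have b: "b > 0" using a c by (simp add: b_def add_pos_pos)
  define x0 where "x0 = max 1 (b powr (2 / e))"
  have "c * (1 + ln x) ^ r < x powr e" if x: "x > x0" for x
  proof -
    have x1: "x > 1" and xb: "x > b powr (2 / e)" using x by (auto simp: x0_def)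
    have "1 + ln x \<le> x powr a + x powr a / a"
      using ln_powr_bound[of x a] ge_one_powr_ge_zero[of x a] x1 a by (intro add_mono) auto
    also have "\<dots> = (1 + 1 / a) * x powr a" by (simp add: algebra_simps)
    finally have "(1 + ln x) ^ r \<le> ((1 + 1 / a) * x powr a) ^ r"
      using x1 by (intro power_mono) auto
    also have "\<dots> = (1 + 1 / a) ^ r * x powr (e / 2)"
      using x1 r by (simp add: power_mult_distrib powr_power a_def)
    finally have "c * (1 + ln x) ^ r \<le> b * x powr (e / 2)"
      using c by (simp add: b_def mult.assoc mult_left_mono)
    also have "b = (b powr (2 / e)) powr (e / 2)" using b e by (simp add: powr_powr)
    also have "\<dots> < x powr (e / 2)" using xb e by (intro powr_less_mono2) auto
    finally have "c * (1 + ln x) ^ r < x powr (e / 2) * x powr (e / 2)" using x1 by simp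
    then show ?thesis by (simp flip: powr_add)
  qed
  moreover have "x0 \<ge> 1" by (simp add: x0_def)
  ultimately show ?thesis by blast
qed

lemma admissible_if_large:
  fixes q d :: nat and \<epsilon> :: real
  defines "L \<equiv> 1 + ln (real q)"
  assumes eps: "\<epsilon> > 0" and d: "d \<ge> 2" and d_le: "real d \<le> real q powr (1 / 4 - \<epsilon>)"
    and dvd: "d dvd q - 1" and q: "q > 544"
    and large1: "131072 * L ^ 6 < real q powr (2 * \<epsilon>)"
    and large2: "100 * L ^ 4 < real q powr (1 / 4)"
  shows "admissible q d"
proof -
  define x where "x = real q powr (1 / 4)"
  have q0: "real q > 0" using q by simp
  have x4: "real q = x ^ 4" using q by (simp add: x_def powr_power)
  have x0: "x > 0" using q by (simp add: x_def)
  have lam1: "L \<ge> 1" using q by (simp add: L_def)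
  have lam_pow: "L ^ i \<le> L ^ 4" if "i \<le> 4" for i using lam1 that by (rule power_increasing[rotated])
  have x_large: "100 * L ^ i < x" if "i \<le> 4" for i using large2 lam_pow[OF that] by (simp add: x_def)
  have x100: "x > 100" using x_large[of 0] by simp
  have dx: "real d * real q powr \<epsilon> \<le> x"
  proof -
    have "real d * real q powr \<epsilon> \<le> real q powr (1 / 4 - \<epsilon>) * real q powr \<epsilon>"
      using d_le by (intro mult_right_mono) auto
    also have "\<dots> = x" by (simp add: x_def flip: powr_add)
    finally show ?thesis .
  qed
  have "real q powr \<epsilon> \<ge> 1" using q eps by (intro ge_one_powr_ge_zero) auto
  then have "real d * 1 \<le> real d * real q powr \<epsilon>" by (intro mult_left_mono) auto
  then have d_le_x: "real d \<le> x" using dx by simp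
  define N where "N = (q - 1) div d"
  have dN: "q = d * N + 1" using dvd q by (simp add: N_def)
  have N_ge: "real N * (2 * real d) \<ge> real q"
  proof -
    have "real q = real d * real N + 1" by (subst dN) simp
    moreover have "real d * real N \<ge> 1" using dN q by (metis One_nat_def Suc_leI add_0 gr0I less_numeral_extra(4) not_numeral_less_one of_nat_1 of_nat_le_iff of_nat_mult)
    ultimately show ?thesis by (simp add: algebra_simps)
  qed
  have N_x: "2 * real N \<ge> x ^ 3"
  proof -
    have "x * x ^ 3 = real q" by (simp add: x4 numeral_eq_Suc)
    also have "\<dots> \<le> 2 * real N * real d" using N_ge by (simp add: mult_ac)
    also have "\<dots> \<le> 2 * real N * x" using d_le_x by (intro mult_left_mono) auto
    finally have "x * x ^ 3 \<le> x * (2 * real N)" by (simp add: mult_ac)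
    then show ?thesis using x0 by simp
  qed
  \<comment> \<open>The least number of shifts for which \<open>d ^ m\<close> reaches the square
    root of \<open>q\<close>. Minimality limits the overshoot to a factor \<open>d\<close>, so
    \<open>d ^ m\<close> lies between \<open>x ^ 2\<close> and \<open>x ^ 3\<close>.\<close>
  define m where "m = (LEAST i. q \<le> d ^ (2 * i))"
  have "q < 2 ^ q" by (rule less_exp)
  also have "(2::nat) ^ q \<le> d ^ q" using d by (rule power_mono) simp
  also have "d ^ q \<le> d ^ (2 * q)" using d by (intro power_increasing) auto
  finally have "q \<le> d ^ (2 * q)" by simp
  then have m_ge: "q \<le> d ^ (2 * m)" unfolding m_def by (rule LeastI)
  have m0: "m > 0" using m_ge q by (intro Nat.gr0I) simp
  then have "m - 1 < m" by simp
  then have m_less: "d ^ (2 * (m - 1)) < q"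
    using not_less_Least[of "m - 1" "\<lambda>i. q \<le> d ^ (2 * i)"] by (simp add: m_def)
  have m_lam: "real m \<le> L"
  proof -
    have "(2::nat) ^ (2 * (m - 1)) \<le> d ^ (2 * (m - 1))" using d by (intro power_mono) auto
    then have "(2::nat) ^ (2 * (m - 1)) < q" using m_less by simp
    then have "real ((2::nat) ^ (2 * (m - 1))) < real q" by (simp only: of_nat_less_iff)
    then have "(4::real) ^ (m - 1) < real q" by (simp add: power_mult)
    then have "ln ((4::real) ^ (m - 1)) < ln (real q)" using q by (subst ln_less_cancel_iff) auto
    then have "real (m - 1) * ln 4 < ln (real q)" by (simp add: ln_realpow)
    moreover have "ln (4::real) \<ge> 1"
      using exp_le ln_le_cancel_iff[of "exp 1" 4] by simp
    then have "real (m - 1) * 1 \<le> real (m - 1) * ln 4" by (intro mult_left_mono) auto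
    ultimately show ?thesis using m0 by (simp add: L_def of_nat_diff)
  qed
  define J where "J = real (d ^ m)"
  have J_sq: "J\<^sup>2 = real (d ^ (2 * m))" by (simp add: J_def power_mult[symmetric] mult.commute)
  have J_ge: "J \<ge> x\<^sup>2"
  proof -
    have "(x\<^sup>2)\<^sup>2 = real q" by (simp add: x4 flip: power_mult)
    also have "\<dots> \<le> real (d ^ (2 * m))" using m_ge by (simp only: of_nat_le_iff)
    finally have "(x\<^sup>2)\<^sup>2 \<le> J\<^sup>2" by (simp only: J_sq)
    then show ?thesis by (rule power2_le_imp_le) (simp add: J_def)
  qed
  have J_le: "J \<le> x ^ 3"
  proof -
    have "2 * m = 2 * (m - 1) + 2" using m0 by simp
    then have "J\<^sup>2 = real (d ^ (2 * (m - 1))) * (real d)\<^sup>2" unfolding J_sq by (metis of_nat_mult of_nat_power power_add)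
    also have "\<dots> \<le> x ^ 4 * x\<^sup>2"
      using m_less d_le_x by (intro mult_mono power_mono) (auto simp flip: x4)
    also have "\<dots> = (x ^ 3)\<^sup>2" by (simp add: power2_eq_square numeral_eq_Suc)
    finally show ?thesis by (rule power2_le_imp_le) (use x0 in simp)
  qed
  have J0: "J > 0" using d by (simp add: J_def)
  have few: "d ^ k * (quadratic_degree k + 1 + k) < q \<and> k * quadratic_degree k < N"
    if k: "2 \<le> k" "k < m" for k
  proof
    have k_lam: "real k \<le> L" using k m_lam by simp
    have L_pos: "L ^ 3 > 0" "L ^ 4 > 0" using lam1 by simp_all
    have k3: "real k ^ i \<le> L ^ i" for i using k_lam by (intro power_mono) auto
    have k1: "1 \<le> real k ^ 3" "real k \<le> real k ^ 3" "(real k)\<^sup>2 \<le> real k ^ 3"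
      using k power_increasing[of 1 3 "real k"] power_increasing[of 2 3 "real k"] by auto
    have size: "real (quadratic_degree k) = 2 * real k ^ 3 + (real k)\<^sup>2 + 1"
      by (simp add: quadratic_degree_def algebra_simps numeral_eq_Suc)
    have "real (d ^ k) \<le> J" unfolding J_def using d k by (simp add: power_increasing)
    then have "real (d ^ k) \<le> x ^ 3" using J_le by simp
    moreover have "real (quadratic_degree k + 1 + k) < x"
    proof -
      have "real (quadratic_degree k + 1 + k) \<le> 6 * real k ^ 3"
        using k1 unfolding of_nat_add of_nat_1 size by linarith
      also have "\<dots> \<le> 100 * L ^ 3" using k3[of 3] L_pos by linarith
      also have "\<dots> < x" by (rule x_large) simp
      finally show ?thesis .
    qed
    ultimately have "real (d ^ k) * real (quadratic_degree k + 1 + k) < x ^ 3 * x"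
      using x0 by (intro mult_le_less_imp_less) (use d in auto)
    also have "\<dots> = real q" by (simp add: x4 numeral_eq_Suc)
    finally have "real (d ^ k * (quadratic_degree k + 1 + k)) < real q" by (simp only: of_nat_mult)
    then show "d ^ k * (quadratic_degree k + 1 + k) < q" by (simp only: of_nat_less_iff)
    have "real (k * quadratic_degree k) \<le> real k * (4 * real k ^ 3)"
    proof -
      have "real (quadratic_degree k) \<le> 4 * real k ^ 3" using k1 unfolding size by linarith
      then show ?thesis unfolding of_nat_mult by (intro mult_left_mono) auto
    qed
    also have "\<dots> = 4 * real k ^ 4" by (simp add: numeral_eq_Suc)
    also have "\<dots> \<le> 4 * L ^ 4" using k3[of 4] by linarith
    also have "\<dots> < x / 2" using x_large[OF order.refl] L_pos by linarith
    also have "\<dots> \<le> x ^ 3 / 2" using power_increasing[of 1 3 x] x100 by simp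
    also have "\<dots> \<le> real N" using N_x by simp
    finally show "k * quadratic_degree k < N" by (simp only: of_nat_less_iff)
  qed
  \<comment> \<open>The condition \<open>small\<close> allows \<open>J * (D + 1 + m)\<close> up to
    \<open>q\<close>: a quarter of \<open>q\<close> is spent on \<open>J * D\<close>, and
    \<open>J * (1 + m)\<close> takes at most half.\<close>
  define D where "D = nat \<lfloor>x ^ 4 / (4 * J)\<rfloor>"
  have D_le: "J * real D \<le> x ^ 4 / 4"
  proof -
    have "real D \<le> x ^ 4 / (4 * J)" using x0 J0 by (simp add: D_def)
    then show ?thesis using J0 by (simp add: field_simps)
  qed
  have D_ge: "J * real D \<ge> x ^ 4 / 8"
  proof -
    have "real D > x ^ 4 / (4 * J) - 1" unfolding D_def using x0 J0 by linarith
    then have "J * real D \<ge> J * (x ^ 4 / (4 * J) - 1)" using J0 by (intro mult_left_mono) auto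
    also have "J * (x ^ 4 / (4 * J) - 1) = x ^ 4 / 4 - J" using J0 by (simp add: field_simps)
    finally have "J * real D \<ge> x ^ 4 / 4 - x ^ 3" using J_le by simp
    moreover have "x ^ 3 * 8 \<le> x ^ 3 * x" using x100 by (intro mult_left_mono) auto
    then have "8 * x ^ 3 \<le> x ^ 4" by (simp add: numeral_eq_Suc mult_ac)
    ultimately show ?thesis by simp
  qed
  \<comment> \<open>About the square root of \<open>q\<close> over \<open>8 * L\<close>; since
    \<open>m \<le> L\<close>, the divisor \<open>L\<close> keeps the quadratic term
    \<open>m * M ^ 2\<close> of the count at most \<open>q / 64\<close>.\<close>
  define M where "M = nat \<lfloor>x\<^sup>2 / (8 * L)\<rfloor>"
  have M_le: "real M \<le> x\<^sup>2 / (8 * L)" using lam1 by (simp add: M_def)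
  have M_ge: "real M \<ge> x\<^sup>2 / (16 * L)"
  proof -
    have "x * 1 \<le> x * x" using x100 by (intro mult_left_mono) auto
    then have "x \<le> x\<^sup>2" by (simp add: power2_eq_square)
    then have "16 * L \<le> x\<^sup>2" using x_large[of 1] lam1 by simp
    then have "x\<^sup>2 / (16 * L) \<ge> 1" using lam1 by (simp add: field_simps)
    moreover have "x\<^sup>2 / (8 * L) = 2 * (x\<^sup>2 / (16 * L))" by simp
    moreover have "real M > x\<^sup>2 / (8 * L) - 1" unfolding M_def using lam1 by linarith
    ultimately show ?thesis by linarith
  qed
  have count: "(\<Sum>l<M. D + m * l) < d ^ m * D"
  proof -
    have "real M \<le> J / 8"
    proof -
      have "x\<^sup>2 / (8 * L) \<le> x\<^sup>2 / 8" using lam1 by (intro divide_left_mono) auto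
      then show ?thesis using M_le J_ge by simp
    qed
    then have 1: "real M * real D \<le> J * real D / 8" using mult_right_mono[of "real M" "J / 8" "real D"] by simp
    have "real m * (real M * real M) \<le> L * (x\<^sup>2 / (8 * L) * (x\<^sup>2 / (8 * L)))"
      using m_lam M_le lam1 by (intro mult_mono) auto
    also have "\<dots> = x ^ 4 / (64 * L)" using lam1 by (simp add: field_simps power2_eq_square numeral_eq_Suc)
    also have "\<dots> \<le> x ^ 4 / 64" using lam1 by (intro divide_left_mono) auto
    finally have 2: "real m * (real M * real M) \<le> J * real D / 8" using D_ge by simp
    have "J * real D > 0" using D_ge x0 by (smt (verit) divide_pos_pos zero_less_power)
    then have 3: "2 * real M * real D + real m * (real M * real M) < 2 * (J * real D)" using 1 2 by linarith
    have "2 * (\<Sum>l<M. D + m * l) \<le> 2 * M * D + m * (M * M)"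
      unfolding sum_arith_lessThan by (intro add_mono mult_le_mono) auto
    then have "real (2 * (\<Sum>l<M. D + m * l)) \<le> real (2 * M * D + m * (M * M))" by (simp only: of_nat_le_iff)
    also have "\<dots> = 2 * real M * real D + real m * (real M * real M)" by simp
    also have "\<dots> < 2 * (J * real D)" by (rule 3)
    also have "\<dots> = real (2 * (d ^ m * D))" by (simp add: J_def)
    finally have "2 * (\<Sum>l<M. D + m * l) < 2 * (d ^ m * D)" by (simp only: of_nat_less_iff)
    then show ?thesis by simp
  qed
  have small: "d ^ m * (D + 1 + m) < q"
  proof -
    have "J * (1 + real m) \<le> x ^ 3 * (2 * L)" using J_le m_lam lam1 x0 by (intro mult_mono) auto
    also have "\<dots> \<le> x ^ 3 * (x / 2)" using x_large[of 1] lam1 x0 by (intro mult_left_mono) auto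
    finally have "J * (1 + real m) \<le> x ^ 4 / 2" by (simp add: numeral_eq_Suc)
    moreover have "x ^ 4 > 0" using x0 by simp
    ultimately have "J * (real D + 1 + real m) < x ^ 4" using D_le unfolding distrib_left by linarith
    also have "J * (real D + 1 + real m) = real (d ^ m * (D + 1 + m))"
      by (simp only: J_def of_nat_mult of_nat_add of_nat_1)
    finally show ?thesis unfolding x4[symmetric] by (simp only: of_nat_less_iff)
  qed
  have final: "(D + N * (m * (d - 1))) ^ 3 < M ^ 3 * N\<^sup>2"
  proof -
    have "real (N * (d - 1)) \<le> x ^ 4"
    proof -
      have "N * (d - 1) \<le> N * d" by simp
      also have "\<dots> \<le> q" by (subst dN) simp
      finally show ?thesis unfolding x4[symmetric] by (simp only: of_nat_le_iff)
    qed
    then have "real m * real (N * (d - 1)) \<le> L * x ^ 4" using m_lam lam1 by (intro mult_mono) auto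
    moreover have "real D \<le> L * x ^ 4"
    proof -
      have "1 \<le> J" using d by (simp add: J_def)
      then have "1 * real D \<le> J * real D" by (intro mult_right_mono) auto
      moreover have "1 * x ^ 4 \<le> L * x ^ 4" using lam1 x0 by (intro mult_right_mono) auto
      ultimately show ?thesis using D_le by simp
    qed
    ultimately have U: "real D + real m * real (N * (d - 1)) \<le> 2 * L * x ^ 4" by simp
    have "real ((D + N * (m * (d - 1))) ^ 3) = (real D + real m * real (N * (d - 1))) ^ 3"
      by (simp add: mult_ac)
    also have "\<dots> \<le> (2 * L * x ^ 4) ^ 3" using U by (intro power_mono) auto
    also have "\<dots> = 8 * L ^ 3 * x ^ 12" by (simp add: power_mult_distrib flip: power_mult)
    \<comment> \<open>This is \<open>large1\<close> after clearing denominators: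
      \<open>8 * 16 ^ 3 * 2 ^ 2 = 131072\<close>, and a factor \<open>L ^ 3\<close> from either side
      makes \<open>L ^ 6\<close>.\<close>
    also have "\<dots> < (x\<^sup>2 / (16 * L)) ^ 3 * (x ^ 3 * real q powr \<epsilon> / 2)\<^sup>2"
    proof -
      have "131072 * L ^ 6 * x ^ 12 < real q powr (2 * \<epsilon>) * x ^ 12" using large1 x0 by (intro mult_strict_right_mono) auto
      moreover have "(x\<^sup>2 / (16 * L)) ^ 3 * (x ^ 3 * real q powr \<epsilon> / 2)\<^sup>2 = real q powr (2 * \<epsilon>) * x ^ 12 / (16384 * L ^ 3)"
      proof -
        have "(real q powr \<epsilon>)\<^sup>2 = real q powr (2 * \<epsilon>)" using q0 by (simp add: powr_power)
        then show ?thesis using lam1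
          by (simp add: power_divide power_mult_distrib flip: power_mult power_add)
      qed
      moreover have "8 * L ^ 3 * x ^ 12 = 131072 * L ^ 6 * x ^ 12 / (16384 * L ^ 3)"
        using lam1 by (simp add: field_simps flip: power_add)
      moreover have "16384 * L ^ 3 > 0" using lam1 by simp
      ultimately show ?thesis by (simp only: divide_strict_right_mono)
    qed
    also have "\<dots> \<le> real M ^ 3 * (real N)\<^sup>2"
    proof (intro mult_mono power_mono M_ge)
      have "x * (x ^ 3 * real q powr \<epsilon>) = real q * real q powr \<epsilon>" by (simp add: x4 numeral_eq_Suc)
      also have "\<dots> \<le> real N * (2 * real d) * real q powr \<epsilon>" using N_ge by (intro mult_right_mono) auto
      also have "\<dots> = 2 * real N * (real d * real q powr \<epsilon>)" by simp
      also have "\<dots> \<le> 2 * real N * x" using dx by (intro mult_left_mono) auto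
      finally have "x * (x ^ 3 * real q powr \<epsilon>) \<le> x * (2 * real N)" by (simp add: mult_ac)
      then show "x ^ 3 * real q powr \<epsilon> / 2 \<le> real N" using x0 by simp
    qed (use lam1 x0 in auto)
    also have "\<dots> = real (M ^ 3 * N\<^sup>2)" by simp
    finally show ?thesis by (simp only: of_nat_less_iff)
  qed
  show ?thesis unfolding admissible_def
    using q m0 few count small final unfolding N_def by blast
qed

theorem theorem1p8:
  fixes \<epsilon> :: real
  assumes "\<epsilon> > 0"
  shows "\<exists>Q P :: real. \<forall>(F :: 'a ring) (q :: nat) (p :: nat) (n :: nat) (d :: nat) (\<delta> :: real).
    field F \<and> finite (carrier F) \<and> card (carrier F) = q \<and>
    prime p \<and> q = p ^ n \<and> real q > Q \<and> real p > P \<and> \<delta> > 0 \<and>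
    d dvd q - 1 \<and> 2 \<le> d \<and> real d \<le> real q powr (1 / 4 - \<epsilon>) * \<delta> powr (3 / 2) \<and>
    delta_good \<delta> p n d
    \<longrightarrow> \<not> (\<exists>A B C. A \<subseteq> carrier F \<and> B \<subseteq> carrier F \<and> C \<subseteq> carrier F \<and>
            card A \<ge> 2 \<and> card B \<ge> 2 \<and> card C \<ge> 2 \<and>
            nonzero_powers F d = A <+>\<^bsub>F\<^esub> B <+>\<^bsub>F\<^esub> C)"
proof -
  obtain X1 :: real where X1: "\<And>x. x > X1 \<Longrightarrow> 131072 * (1 + ln x) ^ 6 < x powr (2 * \<epsilon>)"
    using ln_power_less_powr[of 131072 "2 * \<epsilon>" 6] assms by auto
  obtain X2 :: real where X2: "\<And>x. x > X2 \<Longrightarrow> 100 * (1 + ln x) ^ 4 < x powr (1 / 4)"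
    using ln_power_less_powr[of 100 "1 / 4" 4] by auto
  show ?thesis
  \<comment> \<open>The threshold 544 is that of the case \<open>d = 2\<close> with a pair; beyond
    \<open>X1\<close> and \<open>X2\<close> the powers of \<open>q\<close> dominate the logarithmic
    factors.\<close>
  proof (intro exI allI impI notI)
    fix F :: "'a ring" and q p n d :: nat and \<delta> :: real
    assume *: "field F \<and> finite (carrier F) \<and> card (carrier F) = q \<and>
      prime p \<and> q = p ^ n \<and> real q > max 544 (max X1 X2) \<and> real p > 0 \<and> \<delta> > 0 \<and>
      d dvd q - 1 \<and> 2 \<le> d \<and> real d \<le> real q powr (1 / 4 - \<epsilon>) * \<delta> powr (3 / 2) \<and>
      delta_good \<delta> p n d"
      and dec: "\<exists>A B C. A \<subseteq> carrier F \<and> B \<subseteq> carrier F \<and> C \<subseteq> carrier F \<and>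
            card A \<ge> 2 \<and> card B \<ge> 2 \<and> card C \<ge> 2 \<and>
            nonzero_powers F d = A <+>\<^bsub>F\<^esub> B <+>\<^bsub>F\<^esub> C"
    then have q: "q > 544" "real q > X1" "real q > X2" by auto
    from * obtain e :: "nat \<Rightarrow> nat"
      where "\<forall>j. 2 * j < n + 1 \<longrightarrow> int (e j) \<le> \<lfloor>(1 - \<delta>) * (real p - 1)\<rfloor>"
      unfolding delta_good_def by blast
    \<comment> \<open>A digit is nonnegative, so its bound at \<open>j = 0\<close> forces
      \<open>\<delta> \<le> 1\<close>, and the factor \<open>\<delta> powr (3 / 2)\<close> is at
      most 1.\<close>
    then have "int (e 0) \<le> \<lfloor>(1 - \<delta>) * (real p - 1)\<rfloor>" by simp
    then have "(1 - \<delta>) * (real p - 1) \<ge> 0" by linarith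
    moreover have "real p - 1 > 0" using * prime_gt_1_nat[of p] by simp
    ultimately have "\<delta> \<le> 1" by (simp add: zero_le_mult_iff)
    then have "\<delta> powr (3 / 2) \<le> 1" using * by (simp add: powr_le1)
    then have "real q powr (1 / 4 - \<epsilon>) * \<delta> powr (3 / 2) \<le> real q powr (1 / 4 - \<epsilon>) * 1"
      by (intro mult_left_mono) auto
    moreover have "real d \<le> real q powr (1 / 4 - \<epsilon>) * \<delta> powr (3 / 2)" using * by blast
    ultimately have "real d \<le> real q powr (1 / 4 - \<epsilon>)" by linarith
    then have "admissible q d"
      using * assms q by (intro admissible_if_large[of \<epsilon>] X1 X2) auto
    then have "has_ternary_decomposition F"
      using * dec unfolding has_ternary_decomposition_def by blast
    then show False using * not_has_ternary_decomposition by blast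
  qed
qed

end
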